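(* Let $k$ be a field, let $n\ge 3$, and let $\mathcal A=\{d_1,\ldots,d_n\}\subset\mathbb Z^+$ be a generalized arithmetic sequence with $\gcd(\mathcal A)=1$. Then the toric ideal $I_{\mathcal A^\star}$ is a complete intersection if and only if $n=3$, $\mathcal A$ is an arithmetic sequence (i.e. $d_1,d_2,d_3$ is an increasing arithmetic sequence) and $d_1$ is even.
   Context: $\mathbb N$ denotes the nonnegative integers and $\mathbb Z^+$ the positive integers. For $\mathcal A=\{d_1,\ldots,d_n\}\subset\mathbb Z^+$ put $D:=\max(\mathcal A)$ and $\mathcal A^\star:=\{a_1,\ldots,a_{n+1}\}\subset\mathbb N^2$ with $a_i:=(d_i,D-d_i)$ for $1\le i\le n$ and $a_{n+1}:=(0,D)$. The toric ideal $I_{\mathcal A^\star}$ (the toric ideal of the projective closure of the affine monomial curve $x_i=t^{d_i}$) is the kernel of the $k$-algebra homomorphism $k[x_1,\ldots,x_{n+1}]\to k[t,u]$, $x_i\mapsto t^{d_i}u^{D-d_i}$ $(1\le i\le n)$, $x_{n+1}\mapsto u^{D}$. It is a homogeneous ideal of height $n-1$; it is a complete intersection if its minimal number of generators equals $n-1$. $\{d_1,\ldots,d_n\}$ is a generalized arithmetic sequence if there exists $h\in\mathbb Z^+$ such that $hd_1,d_2,\ldots,d_n$ is an increasing arithmetic sequence. *)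

theory Defs
  imports
    "HOL-Algebra.Ideal"
    "HOL-Algebra.RingHom"
    "HOL-Library.Poly_Mapping"
    "HOL-Library.Extended_Nat"
begin

text \<open>
  Polynomials are finitely supported maps from monomials to coefficients, and monomials are
  finitely supported maps from variable indices to exponents. The type has infinitely many
  variables, so the ring \<open>k[x_i | i \<in> V]\<close> is the carrier-based subring of those polynomials
  that involve only variables with index in \<open>V\<close>.
\<close>

type_synonym 'k mpoly = "(nat \<Rightarrow>\<^sub>0 nat) \<Rightarrow>\<^sub>0 'k"

definition mpoly_ring :: "nat set \<Rightarrow> 'k::field mpoly ring" where
  "mpoly_ring V =
     \<lparr>carrier = {p. \<forall>m \<in> Poly_Mapping.keys p. Poly_Mapping.keys m \<subseteq> V},
      mult = (*), one = 1, zero = 0, add = (+)\<rparr>"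

definition mvar :: "nat \<Rightarrow> 'k::field mpoly" where
  "mvar i = Poly_Mapping.single (Poly_Mapping.single i 1) 1"

definition mconst :: "'k::field \<Rightarrow> 'k mpoly" where
  "mconst c = Poly_Mapping.single 0 c"

definition msubst :: "(nat \<Rightarrow> 'k::field mpoly) \<Rightarrow> 'k mpoly \<Rightarrow> 'k mpoly" where
  "msubst f p =
     (\<Sum>m\<in>Poly_Mapping.keys p.
        mconst (Poly_Mapping.lookup p m) *
        (\<Prod>i\<in>Poly_Mapping.keys m. f i ^ Poly_Mapping.lookup m i))"

text \<open>
  The sequence \<open>d_1, \<dots>, d_n\<close> is given by a function \<open>d\<close>, of which only the values on
  \<open>{1..n}\<close> are used. In the target ring \<open>k[t,u]\<close> the variable with index 1 is \<open>t\<close> and the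
  variable with index 2 is \<open>u\<close>.
\<close>

definition toric_image :: "nat \<Rightarrow> (nat \<Rightarrow> nat) \<Rightarrow> nat \<Rightarrow> 'k::field mpoly" where
  "toric_image n d i =
     (let D = Max (d ` {1..n}) in
      if i = n + 1 then mvar 2 ^ D else mvar 1 ^ d i * mvar 2 ^ (D - d i))"

definition proj_toric_ideal :: "nat \<Rightarrow> (nat \<Rightarrow> nat) \<Rightarrow> 'k::field mpoly set" where
  "proj_toric_ideal n d =
     a_kernel (mpoly_ring {1..n + 1}) (mpoly_ring {1, 2}) (msubst (toric_image n d))"

text \<open>The infimum over the empty set is \<open>\<infinity>\<close>, the value for ideals that are not finitely generated.\<close>

definition min_num_generators :: "('a, 'b) ring_scheme \<Rightarrow> 'a set \<Rightarrow> enat" where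
  "min_num_generators R I =
     (INF G \<in> {G. finite G \<and> G \<subseteq> carrier R \<and> Idl\<^bsub>R\<^esub> G = I}. enat (card G))"

text \<open>The number \<open>n - 1\<close> is the height of the toric ideal in the ring in \<open>n + 1\<close> variables.\<close>

definition proj_toric_complete_intersection ::
    "'k::field itself \<Rightarrow> nat \<Rightarrow> (nat \<Rightarrow> nat) \<Rightarrow> bool" where
  "proj_toric_complete_intersection _ n d \<longleftrightarrow>
     min_num_generators (mpoly_ring {1..n + 1}) (proj_toric_ideal n d :: 'k mpoly set)
       = enat (n - 1)"

definition increasing_arithmetic_sequence :: "nat \<Rightarrow> (nat \<Rightarrow> nat) \<Rightarrow> bool" where
  "increasing_arithmetic_sequence n d \<longleftrightarrow> (\<exists>e>0. \<forall>i\<in>{1..<n}. d (i + 1) = d i + e)"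

definition generalized_arithmetic_sequence :: "nat \<Rightarrow> (nat \<Rightarrow> nat) \<Rightarrow> bool" where
  "generalized_arithmetic_sequence n d \<longleftrightarrow>
     (\<exists>h>0. increasing_arithmetic_sequence n (d(1 := h * d 1)))"

end

theory Submission
  imports Defs
begin

text \<open>
  The number of generators of \<open>I\<close> is bounded below by the dimension of \<open>I\<close> modulo its product with
  the irrelevant ideal. If a monomial shares no variable with any other monomial of its fibre, its
  coefficient is a linear functional that factors through this quotient. For each of the \<open>n - 1\<close> variables other
  than the two extreme ones, the least power that can be exchanged in its fibre is such a monomial.
  Hence \<open>I\<close> is not a complete intersection as soon as there is one further such monomial
  that is not a pure power. With \<open>e\<close> the difference of the sequence and \<open>x_0 = x_{n+1}\<close>, it comes from
  \<open>x_2 x_5 - x_3 x_4\<close> if \<open>n \<ge> 5\<close>,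
  from \<open>x_1 x_4 - x_2 x_3\<close> if \<open>n = 4\<close> and \<open>h = 1\<close>,
  from \<open>x_1^e x_2 - x_0^e x_3\<close> if \<open>h \<ge> 2\<close> and \<open>d_1 = 1\<close>,
  from \<open>x_1^h x_3 - x_0^(h-1) x_2^2\<close> if \<open>n \<le> 4\<close>, \<open>h \<ge> 2\<close> and \<open>d_1 \<ge> 2\<close>,
  and from \<open>x_0^e x_3^r - x_1^(e+r-1) x_2\<close> with \<open>r = (d_1 + 1)/2\<close> if \<open>n = 3\<close>, \<open>h = 1\<close> and \<open>d_1\<close> is odd.
  If \<open>n = 3\<close>, \<open>h = 1\<close> and \<open>d_1 = 2 a\<close>, the two binomials \<open>x_2^2 - x_1 x_3\<close> and
  \<open>x_1^(a+e) - x_3^a x_0^e\<close> reduce every monomial to a normal form, and distinct normal forms lie in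
  distinct fibres.
\<close>

section \<open>Push-forward of polynomials along a grading\<close>

lemma sum_single_keys: "(\<Sum>m\<in>Poly_Mapping.keys p. Poly_Mapping.single m (Poly_Mapping.lookup p m)) = p"
  by (rule poly_mapping_eqI)
    (auto simp: lookup_sum lookup_single when_def in_keys_iff intro!: sum.delta'[THEN trans])

text \<open>The linear map of monoid algebras induced by \<open>w\<close> on monomials. No
  additivity is built in, because the map is also applied to a mere choice of fibre
  representatives.\<close>

definition push :: "('a \<Rightarrow> 'b) \<Rightarrow> ('a \<Rightarrow>\<^sub>0 'c::comm_monoid_add) \<Rightarrow> 'b \<Rightarrow>\<^sub>0 'c" where
  "push w p = (\<Sum>m\<in>Poly_Mapping.keys p. Poly_Mapping.single (w m) (Poly_Mapping.lookup p m))"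

lemma push_superset:
  assumes "finite A" "Poly_Mapping.keys p \<subseteq> A"
  shows "push w p = (\<Sum>m\<in>A. Poly_Mapping.single (w m) (Poly_Mapping.lookup p m))"
  unfolding push_def using assms by (intro sum.mono_neutral_left) (auto simp: in_keys_iff)

lemma lookup_push:
  "Poly_Mapping.lookup (push w p) s
    = (\<Sum>m\<in>Poly_Mapping.keys p. Poly_Mapping.lookup p m when w m = s)"
  by (simp add: push_def lookup_sum lookup_single)

lemma push_zero [simp]: "push w 0 = 0"
  by (simp add: push_def)

lemma push_single [simp]: "push w (Poly_Mapping.single m c) = Poly_Mapping.single (w m) c"
  by (cases "c = 0") (auto simp: push_def)

lemma push_add: "push w (p + q) = push w p + push w q"
proof -
  let ?A = "Poly_Mapping.keys p \<union> Poly_Mapping.keys q"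
  have "push w (p + q) = (\<Sum>m\<in>?A. Poly_Mapping.single (w m) (Poly_Mapping.lookup (p + q) m))"
    by (rule push_superset) (auto dest!: subsetD[OF keys_add])
  also have "\<dots> = push w p + push w q"
    by (subst (1 2) push_superset[where A = ?A]) (auto simp: lookup_add single_add sum.distrib)
  finally show ?thesis .
qed

lemma push_sum: "push w (\<Sum>i\<in>A. f i) = (\<Sum>i\<in>A. push w (f i))"
  by (induction A rule: infinite_finite_induct) (auto simp: push_add)

lemma push_uminus: "push w (- p) = - push w (p :: 'a \<Rightarrow>\<^sub>0 'c::ab_group_add)"
  using push_add[of w p "- p"] by (simp add: eq_neg_iff_add_eq_0 add.commute)

lemma push_diff: "push w (p - q) = push w p - push w (q :: 'a \<Rightarrow>\<^sub>0 'c::ab_group_add)"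
  using push_add[of w p "- q"] by (simp add: push_uminus)

lemma mult_eq_sum_single:
  fixes p q :: "'a::monoid_add \<Rightarrow>\<^sub>0 'c::semiring_0"
  shows "p * q = (\<Sum>m\<in>Poly_Mapping.keys p. \<Sum>m'\<in>Poly_Mapping.keys q.
    Poly_Mapping.single (m + m') (Poly_Mapping.lookup p m * Poly_Mapping.lookup q m'))"
  by (subst (1) sum_single_keys[of p, symmetric], subst (1) sum_single_keys[of q, symmetric])
    (simp add: sum_product mult_single)

lemma push_mult:
  fixes p q :: "'a::monoid_add \<Rightarrow>\<^sub>0 'c::semiring_0" and w :: "'a \<Rightarrow> 'b::monoid_add"
  assumes "\<And>m m'. w (m + m') = w m + w m'"
  shows "push w (p * q) = push w p * push w q"
  by (subst mult_eq_sum_single)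
    (simp add: push_sum assms push_def[of w p] push_def[of w q] sum_product mult_single)

lemma keys_add_nat: "Poly_Mapping.keys (m + m' :: 'a \<Rightarrow>\<^sub>0 nat) = Poly_Mapping.keys m \<union> Poly_Mapping.keys m'"
  by (auto simp: in_keys_iff lookup_add)

section \<open>Polynomial rings in the variables from a given index set, and their ideals\<close>

lemma mem_carrier_mpoly_ring:
  "p \<in> carrier (mpoly_ring V) \<longleftrightarrow> (\<forall>m\<in>Poly_Mapping.keys p. Poly_Mapping.keys m \<subseteq> V)"
  by (simp add: mpoly_ring_def)

lemma mpoly_ring_simps [simp]:
  "a \<otimes>\<^bsub>mpoly_ring V\<^esub> b = a * b" "a \<oplus>\<^bsub>mpoly_ring V\<^esub> b = a + b"
  "\<one>\<^bsub>mpoly_ring V\<^esub> = 1" "\<zero>\<^bsub>mpoly_ring V\<^esub> = 0"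
  by (simp_all add: mpoly_ring_def)

lemma mpoly_ring_closed [simp]:
  fixes p q :: "'k::field mpoly"
  shows "0 \<in> carrier (mpoly_ring V :: 'k mpoly ring)" "1 \<in> carrier (mpoly_ring V :: 'k mpoly ring)"
    and "p \<in> carrier (mpoly_ring V) \<Longrightarrow> - p \<in> carrier (mpoly_ring V)"
    and "p \<in> carrier (mpoly_ring V) \<Longrightarrow> q \<in> carrier (mpoly_ring V) \<Longrightarrow> p + q \<in> carrier (mpoly_ring V)"
    and "p \<in> carrier (mpoly_ring V) \<Longrightarrow> q \<in> carrier (mpoly_ring V) \<Longrightarrow> p * q \<in> carrier (mpoly_ring V)"
  using keys_add[of p q]
  by (auto simp: mem_carrier_mpoly_ring keys_add_nat dest!: subsetD[OF keys_mult]) blast+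

lemma mpoly_ring_diff_closed [simp]:
  "p \<in> carrier (mpoly_ring V) \<Longrightarrow> q \<in> carrier (mpoly_ring V) \<Longrightarrow> p - q \<in> carrier (mpoly_ring V)"
  using mpoly_ring_closed(4)[of p V "- q"] by simp

lemma mpoly_ring_single [simp]:
  "Poly_Mapping.keys m \<subseteq> V \<Longrightarrow> Poly_Mapping.single m c \<in> carrier (mpoly_ring V)"
  by (auto simp: mem_carrier_mpoly_ring)

lemma cring_mpoly_ring: "cring (mpoly_ring V :: 'k::field mpoly ring)"
proof (rule cringI)
  show "abelian_group (mpoly_ring V :: 'k mpoly ring)"
    by (rule abelian_groupI) (auto simp: algebra_simps intro!: bexI[of _ "- _"])
  show "Group.comm_monoid (mpoly_ring V :: 'k mpoly ring)"
    by (rule Group.comm_monoidI) (auto simp: algebra_simps)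
qed (auto simp: algebra_simps)

lemma mpoly_ring_idealI:
  fixes I :: "'k::field mpoly set"
  assumes "I \<subseteq> carrier (mpoly_ring V)" "0 \<in> I"
    and "\<And>p q. p \<in> I \<Longrightarrow> q \<in> I \<Longrightarrow> p + q \<in> I"
    and mult: "\<And>p r. p \<in> I \<Longrightarrow> r \<in> carrier (mpoly_ring V) \<Longrightarrow> r * p \<in> I"
  shows "ideal I (mpoly_ring V)"
proof -
  interpret cring "mpoly_ring V :: 'k mpoly ring" by (rule cring_mpoly_ring)
  have inv: "\<ominus>\<^bsub>mpoly_ring V\<^esub> p = - p" if "p \<in> carrier (mpoly_ring V)" for p :: "'k mpoly"
    using that by (intro minus_equality) auto
  have neg: "- p \<in> I" if "p \<in> I" for p
    using mult[OF that, of "- 1"] by simp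
  show ?thesis
  proof (rule idealI)
    show "subgroup I (add_monoid (mpoly_ring V))"
      using assms neg inv
      by (intro add.subgroupI) (auto simp: a_inv_def[symmetric])
  qed (use assms in \<open>auto simp: mult.commute ring_axioms\<close>)
qed

text \<open>For additive \<open>w\<close> this is the toric ideal of the grading \<open>w\<close>:
  the coefficients of a member add up to zero over every fibre.\<close>

definition toric_kernel :: "nat set \<Rightarrow> ((nat \<Rightarrow>\<^sub>0 nat) \<Rightarrow> 'b) \<Rightarrow> 'k::field mpoly set" where
  "toric_kernel V w = {p \<in> carrier (mpoly_ring V). push w p = 0}"

lemma ideal_toric_kernel:
  fixes w :: "(nat \<Rightarrow>\<^sub>0 nat) \<Rightarrow> 'b::monoid_add"
  assumes "\<And>m m'. w (m + m') = w m + w m'"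
  shows "ideal (toric_kernel V w) (mpoly_ring V)"
  by (rule mpoly_ring_idealI) (auto simp: toric_kernel_def push_add push_mult assms)

section \<open>A lower bound for the number of generators\<close>

text \<open>Join two monomials of a fibre when they have a common variable; then \<open>u\<close> is
  an isolated vertex of that graph. A monomial alone in its fibre also qualifies, so a second
  monomial of the fibre is demanded separately later.\<close>

definition isolated :: "nat set \<Rightarrow> ((nat \<Rightarrow>\<^sub>0 nat) \<Rightarrow> 'b) \<Rightarrow> (nat \<Rightarrow>\<^sub>0 nat) \<Rightarrow> bool" where
  "isolated V w u \<longleftrightarrow> Poly_Mapping.keys u \<subseteq> V \<and>
     (\<forall>m. Poly_Mapping.keys m \<subseteq> V \<longrightarrow> w m = w u \<longrightarrow> m \<noteq> u \<longrightarrow>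
        Poly_Mapping.keys m \<inter> Poly_Mapping.keys u = {})"

text \<open>No proper divisor of an isolated monomial can be exchanged inside its fibre, so its
  coefficient vanishes on the toric ideal.\<close>

lemma lookup_mult_isolated:
  fixes w :: "(nat \<Rightarrow>\<^sub>0 nat) \<Rightarrow> 'b::cancel_comm_monoid_add" and p r :: "'k::field mpoly"
  assumes w: "\<And>m m'. w (m + m') = w m + w m'"
    and p: "p \<in> toric_kernel V w" and r: "r \<in> carrier (mpoly_ring V)"
    and u: "isolated V w u"
  shows "Poly_Mapping.lookup (r * p) u = Poly_Mapping.lookup r 0 * Poly_Mapping.lookup p u"
proof -
  have van: "Poly_Mapping.lookup p m' = 0" if "m + m' = u" "m \<noteq> 0" "m' \<in> Poly_Mapping.keys p" for m m'
  proof -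
    have uniq: "m'' = m'" if m'': "m'' \<in> Poly_Mapping.keys p" "w m'' = w m'" for m''
    proof (rule ccontr)
      assume "m'' \<noteq> m'"
      hence "m + m'' \<noteq> u" using \<open>m + m' = u\<close> by auto
      moreover have "w (m + m'') = w u" using m'' \<open>m + m' = u\<close> w by metis
      moreover have "Poly_Mapping.keys (m + m'') \<subseteq> V"
        using u p m'' \<open>m + m' = u\<close>
        by (auto simp: isolated_def toric_kernel_def mem_carrier_mpoly_ring keys_add_nat)
      ultimately have "Poly_Mapping.keys (m + m'') \<inter> Poly_Mapping.keys u = {}"
        using u by (auto simp: isolated_def)
      \<comment> \<open>\<open>m\<close> divides both \<open>u\<close> and \<open>m + m''\<close>,
        so disjoint supports leave only \<open>m = 0\<close>.\<close>
      hence "Poly_Mapping.lookup m i = 0" for i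
        using \<open>m + m' = u\<close> by (auto simp: keys_add_nat in_keys_iff)
      thus False using \<open>m \<noteq> 0\<close> by (auto intro: poly_mapping_eqI)
    qed
    \<comment> \<open>As \<open>m'\<close> is the only term of \<open>p\<close> in its fibre, the
      coefficient of \<open>push w p\<close> there is that of \<open>p\<close> at
      \<open>m'\<close>.\<close>
    have "0 = Poly_Mapping.lookup (push w p) (w m')"
      using p by (simp add: toric_kernel_def)
    also have "\<dots> = (\<Sum>m''\<in>Poly_Mapping.keys p. if m'' = m' then Poly_Mapping.lookup p m' else 0)"
      unfolding lookup_push by (rule sum.cong) (auto simp: when_def dest: uniq)
    also have "\<dots> = Poly_Mapping.lookup p m'"
      using \<open>m' \<in> Poly_Mapping.keys p\<close> by simp
    finally show ?thesis by simp
  qed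
  have "Poly_Mapping.lookup (r * p) u = (\<Sum>m\<in>Poly_Mapping.keys r. \<Sum>m'\<in>Poly_Mapping.keys p.
      Poly_Mapping.lookup r m * Poly_Mapping.lookup p m' when m + m' = u)"
    by (subst mult_eq_sum_single) (simp add: lookup_sum lookup_single)
  \<comment> \<open>By \<open>van\<close> and cancellation, the only contribution comes from
    \<open>m = 0\<close> and \<open>m' = u\<close>.\<close>
  also have "\<dots> = (\<Sum>m\<in>Poly_Mapping.keys r. \<Sum>m'\<in>Poly_Mapping.keys p.
      if m' = u then (if m = 0 then Poly_Mapping.lookup r 0 * Poly_Mapping.lookup p u else 0) else 0)"
  proof (intro sum.cong refl)
    fix m m' assume "m' \<in> Poly_Mapping.keys p"
    then show "(Poly_Mapping.lookup r m * Poly_Mapping.lookup p m' when m + m' = u)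
      = (if m' = u then (if m = 0 then Poly_Mapping.lookup r 0 * Poly_Mapping.lookup p u else 0) else 0)"
      using van[of m m'] by (auto simp: when_def)
  qed
  also have "\<dots> = Poly_Mapping.lookup r 0 * Poly_Mapping.lookup p u"
    by (cases "Poly_Mapping.lookup p u = 0") (simp_all add: in_keys_iff)
  finally show ?thesis .
qed

lemma binomial_mem_toric_kernel:
  assumes "Poly_Mapping.keys u \<subseteq> V" "Poly_Mapping.keys v \<subseteq> V" "w u = w v"
  shows "(Poly_Mapping.single u 1 - Poly_Mapping.single v 1 :: 'k::field mpoly) \<in> toric_kernel V w"
  using assms by (simp add: toric_kernel_def push_diff)

section \<open>Polynomials as a vector space over the constants\<close>

lemma mpoly_vector_space: "vector_space (\<lambda>c p. mconst c * (p :: 'k::field mpoly))"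
  by unfold_locales
    (auto simp: mconst_def algebra_simps single_add mult_single mult.assoc[symmetric])

lemma lookup_mconst_mult: "Poly_Mapping.lookup (mconst c * p) m = c * Poly_Mapping.lookup p m"
  by (simp add: mconst_def mult_map_scale_conv_mult[symmetric] Poly_Mapping.map.rep_eq when_def)

lemma independent_monomials:
  assumes "finite U"
  shows "\<not> module.dependent (\<lambda>c p. mconst c * (p :: 'k::field mpoly)) ((\<lambda>u. Poly_Mapping.single u (1::'k)) ` U)"
proof -
  interpret vector_space "\<lambda>c p. mconst c * (p :: 'k mpoly)" by (rule mpoly_vector_space)
  have inj: "inj_on (\<lambda>u. Poly_Mapping.single u (1 :: 'k)) U"
    by (rule inj_onI) (metis lookup_single_eq lookup_single_not_eq zero_neq_one)
  show ?thesis
  proof (rule independent_if_scalars_zero)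
    fix f :: "'k mpoly \<Rightarrow> 'k" and x
    assume s: "(\<Sum>x\<in>(\<lambda>u. Poly_Mapping.single u (1::'k)) ` U. mconst (f x) * x) = 0"
      and "x \<in> (\<lambda>u. Poly_Mapping.single u (1::'k)) ` U"
    then obtain u where u: "u \<in> U" "x = Poly_Mapping.single u 1" by auto
    have "0 = Poly_Mapping.lookup (\<Sum>u\<in>U. mconst (f (Poly_Mapping.single u 1)) * Poly_Mapping.single u 1) u"
      using s by (simp add: sum.reindex[OF inj])
    also have "\<dots> = (\<Sum>u'\<in>U. if u' = u then f x else 0)"
      unfolding lookup_sum
      by (rule sum.cong) (auto simp: lookup_mconst_mult lookup_single when_def u)
    also have "\<dots> = f x" using assms u by simp
    finally show "f x = 0" by simp
  qed (use assms in simp)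
qed

text \<open>By \<open>lookup_mult_isolated\<close> the coefficients at \<open>U\<close> factor through the ideal modulo its product
  with the irrelevant ideal, so a generating set of the ideal spans their image.\<close>

lemma card_le_card_generators:
  fixes w :: "(nat \<Rightarrow>\<^sub>0 nat) \<Rightarrow> 'b::cancel_comm_monoid_add" and G :: "'k::field mpoly set"
  assumes w: "\<And>m m'. w (m + m') = w m + w m'"
    and U: "finite U" "\<And>u. u \<in> U \<Longrightarrow> isolated V w u"
    and partner: "\<And>u. u \<in> U \<Longrightarrow> \<exists>v. Poly_Mapping.keys v \<subseteq> V \<and> w v = w u \<and> v \<notin> U"
    and G: "finite G" "G \<subseteq> carrier (mpoly_ring V)" "Idl\<^bsub>mpoly_ring V\<^esub> G = toric_kernel V w"
  shows "card U \<le> card G"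
proof -
  interpret vs: vector_space "\<lambda>c p. mconst c * (p :: 'k mpoly)" by (rule mpoly_vector_space)
  interpret R: cring "mpoly_ring V :: 'k mpoly ring" by (rule cring_mpoly_ring)
  define res :: "'k mpoly \<Rightarrow> 'k mpoly"
    where "res p = (\<Sum>u\<in>U. Poly_Mapping.single u (Poly_Mapping.lookup p u))" for p
  have res_add: "res (p + q) = res p + res q" for p q
    by (simp add: res_def lookup_add single_add sum.distrib)
  have res_mult: "res (r * p) = mconst (Poly_Mapping.lookup r 0) * res p"
    if "p \<in> toric_kernel V w" "r \<in> carrier (mpoly_ring V)" for r p
    using lookup_mult_isolated[OF w that] U
    by (simp add: res_def sum_distrib_left mconst_def mult_single)
  \<comment> \<open>\<open>K\<close> is an ideal because \<open>res\<close> turns multiplication by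
    \<open>r\<close> into scaling by the constant term of \<open>r\<close>. It contains
    \<open>G\<close>, hence the whole toric ideal.\<close>
  define K where "K = {p \<in> toric_kernel V w. res p \<in> vs.span (res ` G)}"
  have I: "ideal (toric_kernel V w) (mpoly_ring V :: 'k mpoly ring)"
    by (rule ideal_toric_kernel[OF w])
  have "ideal K (mpoly_ring V)"
  proof (rule mpoly_ring_idealI)
    show "K \<subseteq> carrier (mpoly_ring V)" by (auto simp: K_def toric_kernel_def)
    show "0 \<in> K" by (auto simp: K_def toric_kernel_def res_def vs.span_zero)
    show "p + q \<in> K" if "p \<in> K" "q \<in> K" for p q
      using that additive_subgroup.a_closed[OF ideal.axioms(1)[OF I], of p q] by (auto simp: K_def res_add vs.span_add)
    show "r * p \<in> K" if "p \<in> K" "r \<in> carrier (mpoly_ring V)" for p r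
      using that ideal.I_l_closed[OF I, of p r] by (auto simp: K_def res_mult vs.span_scale)
  qed
  moreover have "G \<subseteq> K"
    using R.genideal_self[OF G(2)] G(3) by (auto simp: K_def vs.span_base)
  ultimately have sub: "toric_kernel V w \<subseteq> K"
    using R.genideal_minimal[of K G] G(3) by simp
  let ?M = "(\<lambda>u. Poly_Mapping.single u (1::'k)) ` U"
  have "?M \<subseteq> vs.span (res ` G)"
  proof clarify
    fix u assume u: "u \<in> U"
    \<comment> \<open>The partner lies outside \<open>U\<close>, so \<open>res\<close> maps the
      binomial of \<open>u\<close> and \<open>v\<close> to the monomial \<open>u\<close>
      alone.\<close>
    obtain v where v: "Poly_Mapping.keys v \<subseteq> V" "w v = w u" "v \<notin> U"
      using partner[OF u] by auto
    have "Poly_Mapping.keys u \<subseteq> V" using U(2)[OF u] by (simp add: isolated_def)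
    hence "Poly_Mapping.single u 1 - Poly_Mapping.single v 1 \<in> K"
      using sub binomial_mem_toric_kernel[of u V v w] v by auto
    moreover have "res (Poly_Mapping.single u 1 - Poly_Mapping.single v 1)
        = (\<Sum>u'\<in>U. if u' = u then Poly_Mapping.single u 1 else 0)"
      unfolding res_def using v by (intro sum.cong) (auto simp: lookup_minus lookup_single when_def)
    ultimately show "Poly_Mapping.single u 1 \<in> vs.span (res ` G)"
      using U(1) u by (auto simp: K_def)
  qed
  hence "card ?M \<le> card (res ` G)"
    using vs.independent_span_bound[OF _ independent_monomials[OF U(1)]] G(1) by blast
  also have "card (res ` G) \<le> card G" using G(1) by (rule card_image_le)
  also have "card ?M = card U"
    by (intro card_image inj_onI) (metis lookup_single_eq lookup_single_not_eq zero_neq_one)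
  finally show ?thesis .
qed

section \<open>The toric ideal as a kernel of a push-forward\<close>

text \<open>The exponent vector of the image of a monomial under the toric map, with index 1 for t
  and index 2 for u. An entry \<open>\<delta> i = 0\<close> gives the variable sent to a pure power
  of u.\<close>

definition wt :: "(nat \<Rightarrow> nat) \<Rightarrow> nat \<Rightarrow> (nat \<Rightarrow>\<^sub>0 nat) \<Rightarrow> (nat \<Rightarrow>\<^sub>0 nat)" where
  "wt \<delta> D m =
     Poly_Mapping.single 1 (\<Sum>i\<in>Poly_Mapping.keys m. Poly_Mapping.lookup m i * \<delta> i) +
     Poly_Mapping.single 2 (\<Sum>i\<in>Poly_Mapping.keys m. Poly_Mapping.lookup m i * (D - \<delta> i))"

lemma wt_superset:
  assumes "finite V" "Poly_Mapping.keys m \<subseteq> V"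
  shows "wt \<delta> D m = Poly_Mapping.single 1 (\<Sum>i\<in>V. Poly_Mapping.lookup m i * \<delta> i) +
     Poly_Mapping.single 2 (\<Sum>i\<in>V. Poly_Mapping.lookup m i * (D - \<delta> i))"
proof -
  have "(\<Sum>i\<in>Poly_Mapping.keys m. Poly_Mapping.lookup m i * f i) = (\<Sum>i\<in>V. Poly_Mapping.lookup m i * f i)" for f
    using assms by (intro sum.mono_neutral_left) (auto simp: in_keys_iff)
  thus ?thesis by (simp add: wt_def)
qed

lemma wt_add: "wt \<delta> D (m + m') = wt \<delta> D m + wt \<delta> D m'"
proof -
  let ?V = "Poly_Mapping.keys m \<union> Poly_Mapping.keys m'"
  show ?thesis
    by (subst (1 2 3) wt_superset[of ?V])
      (auto simp: keys_add_nat lookup_add sum.distrib single_add algebra_simps)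
qed

text \<open>The exponents of t and u add up to \<open>D\<close> times the degree, so fixing both
  amounts to fixing the degree and the exponent of t. Fibres are thus described by two linear
  equations.\<close>

lemma wt_eq_iff:
  assumes "finite V" "Poly_Mapping.keys m \<subseteq> V" "Poly_Mapping.keys m' \<subseteq> V"
    and D: "D > 0" "\<And>i. i \<in> V \<Longrightarrow> \<delta> i \<le> D"
  shows "wt \<delta> D m = wt \<delta> D m' \<longleftrightarrow>
    (\<Sum>i\<in>V. Poly_Mapping.lookup m i) = (\<Sum>i\<in>V. Poly_Mapping.lookup m' i) \<and>
    (\<Sum>i\<in>V. Poly_Mapping.lookup m i * \<delta> i) = (\<Sum>i\<in>V. Poly_Mapping.lookup m' i * \<delta> i)"
proof -
  have tot: "(\<Sum>i\<in>V. f i * \<delta> i) + (\<Sum>i\<in>V. f i * (D - \<delta> i)) = D * (\<Sum>i\<in>V. f i)" for f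
  proof -
    have "f i * \<delta> i + f i * (D - \<delta> i) = D * f i" if "i \<in> V" for i
      using D(2)[OF that] by (simp add: add_mult_distrib2[symmetric])
    thus ?thesis by (simp add: sum.distrib[symmetric] sum_distrib_left)
  qed
  have eq: "a = a' \<and> b = b'"
    if "Poly_Mapping.single 1 a + Poly_Mapping.single 2 b = Poly_Mapping.single (1::nat) a' + Poly_Mapping.single 2 b'"
    for a b a' b' :: nat
    using arg_cong[OF that, of "\<lambda>p. Poly_Mapping.lookup p 1"] arg_cong[OF that, of "\<lambda>p. Poly_Mapping.lookup p 2"]
    by (simp add: lookup_add lookup_single)
  show ?thesis
  proof
    assume "wt \<delta> D m = wt \<delta> D m'"
    from eq[OF this[unfolded wt_superset[OF assms(1,2)] wt_superset[OF assms(1,3)]]]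
    show "(\<Sum>i\<in>V. Poly_Mapping.lookup m i) = (\<Sum>i\<in>V. Poly_Mapping.lookup m' i) \<and>
      (\<Sum>i\<in>V. Poly_Mapping.lookup m i * \<delta> i) = (\<Sum>i\<in>V. Poly_Mapping.lookup m' i * \<delta> i)"
      using tot[of "Poly_Mapping.lookup m"] tot[of "Poly_Mapping.lookup m'"] D(1) by simp
  next
    assume "(\<Sum>i\<in>V. Poly_Mapping.lookup m i) = (\<Sum>i\<in>V. Poly_Mapping.lookup m' i) \<and>
      (\<Sum>i\<in>V. Poly_Mapping.lookup m i * \<delta> i) = (\<Sum>i\<in>V. Poly_Mapping.lookup m' i * \<delta> i)"
    moreover from this have "(\<Sum>i\<in>V. Poly_Mapping.lookup m i * (D - \<delta> i)) = (\<Sum>i\<in>V. Poly_Mapping.lookup m' i * (D - \<delta> i))"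
      using tot[of "Poly_Mapping.lookup m"] tot[of "Poly_Mapping.lookup m'"] by simp
    ultimately show "wt \<delta> D m = wt \<delta> D m'"
      by (simp add: wt_superset[OF assms(1,2)] wt_superset[OF assms(1,3)])
  qed
qed

text \<open>Every variable goes to a monomial with coefficient 1, so the substitution merely
  relabels monomials.\<close>

lemma msubst_eq_push:
  assumes "\<And>i. f i = mvar 1 ^ \<delta> i * mvar 2 ^ (D - \<delta> i)"
  shows "msubst f p = push (wt \<delta> D) (p :: 'k::field mpoly)"
proof -
  let ?M = "\<lambda>a b. Poly_Mapping.single (Poly_Mapping.single (1::nat) (a::nat) + Poly_Mapping.single 2 b) (1::'k)"
  have var_power: "mvar i ^ k = Poly_Mapping.single (Poly_Mapping.single i k) (1::'k)" for i k
    by (induction k) (auto simp: mvar_def mult_single single_add[symmetric])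
  have f: "f i = ?M (\<delta> i) (D - \<delta> i)" for i
    by (simp add: assms var_power mult_single)
  have pow: "?M a b ^ k = ?M (k * a) (k * b)" for a b k
    by (induction k) (auto simp: mult_single single_add ac_simps)
  have prod: "(\<Prod>i\<in>A. ?M (g i) (h i)) = ?M (\<Sum>i\<in>A. g i) (\<Sum>i\<in>A. h i)" if "finite A" for A :: "nat set" and g h
    using that by (induction A rule: finite_induct) (auto simp: mult_single single_add ac_simps)
  show ?thesis
    unfolding msubst_def push_def
    by (intro sum.cong refl) (simp add: f pow prod wt_def mconst_def mult_single del: One_nat_def)
qed

text \<open>Setting \<open>d\<close> to 0 at \<open>n + 1\<close> absorbs the exceptional case of
  \<open>toric_image\<close>, so that all variables have the same form.\<close>

lemma proj_toric_ideal_eq: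
  assumes "Max (d ` {1..n}) = D"
  shows "proj_toric_ideal n d = toric_kernel {1..n + 1} (wt (d(n + 1 := 0)) D)"
proof -
  have "msubst (toric_image n d) p = push (wt (d(n + 1 := 0)) D) (p :: 'a mpoly)" for p
    by (rule msubst_eq_push) (simp add: toric_image_def assms del: One_nat_def)
  thus ?thesis
    by (simp add: proj_toric_ideal_def toric_kernel_def a_kernel_def')
qed

section \<open>Critical binomials\<close>

definition pure_power :: "(nat \<Rightarrow>\<^sub>0 nat) \<Rightarrow> bool" where
  "pure_power u \<longleftrightarrow> (\<exists>i c. u = Poly_Mapping.single i c)"

lemma sum_lookup_single:
  assumes "finite V" "k \<in> V"
  shows "(\<Sum>j\<in>V. Poly_Mapping.lookup (Poly_Mapping.single k c) j * f j) = (c::nat) * f k"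
    and "(\<Sum>j\<in>V. Poly_Mapping.lookup (Poly_Mapping.single k c) j) = c"
  using assms by (simp_all add: lookup_single when_def if_distrib if_distribR cong: if_cong)

text \<open>Take the least \<open>c\<close> for which the power of the variable \<open>i\<close>
  shares its fibre with another monomial. If such a monomial contained the variable, one factor
  could be cancelled on both sides, against minimality.\<close>

lemma critical_exponent:
  assumes V: "finite V" "\<And>i. i \<in> V \<Longrightarrow> \<delta> i \<le> D"
    and lr: "l \<in> V" "r \<in> V" "\<delta> l = 0" "\<delta> r = D"
    and i: "i \<in> V" "0 < \<delta> i" "\<delta> i < D"
  shows "\<exists>c>0. isolated V (wt \<delta> D) (Poly_Mapping.single i c) \<and>
    (\<exists>v. Poly_Mapping.keys v \<subseteq> V \<and> wt \<delta> D v = wt \<delta> D (Poly_Mapping.single i c) \<and> v \<noteq> Poly_Mapping.single i c)"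
proof -
  define P where "P c \<longleftrightarrow> (\<exists>v. Poly_Mapping.keys v \<subseteq> V \<and>
    wt \<delta> D v = wt \<delta> D (Poly_Mapping.single i c) \<and> v \<noteq> Poly_Mapping.single i c)" for c
  have D: "D > 0" using i by simp
  \<comment> \<open>Degree \<open>D\<close> and weight \<open>D * \<delta> i\<close> agree with
    those of the \<open>D\<close>-th power of the variable \<open>i\<close>, so exchangeable
    exponents exist.\<close>
  let ?v = "Poly_Mapping.single l (D - \<delta> i) + Poly_Mapping.single r (\<delta> i)"
  have "Poly_Mapping.keys ?v \<subseteq> V" using lr by (auto simp: keys_add_nat)
  moreover from this have "wt \<delta> D ?v = wt \<delta> D (Poly_Mapping.single i D)"
    using i lr by (subst wt_eq_iff[OF V(1) _ _ D V(2)])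
      (auto simp: lookup_add sum.distrib add_mult_distrib sum_lookup_single V(1))
  moreover have "Poly_Mapping.lookup ?v i \<noteq> Poly_Mapping.lookup (Poly_Mapping.single i D) i"
    using i lr by (auto simp: lookup_add lookup_single when_def)
  ultimately have "P D" unfolding P_def by metis
  define c where "c = (LEAST c. P c)"
  have Pc: "P c" unfolding c_def by (rule LeastI[of P, OF \<open>P D\<close>])
  \<comment> \<open>In degree zero there is only the monomial 1, so its fibre offers no
    exchange.\<close>
  have "c \<noteq> 0"
  proof
    assume "c = 0"
    then obtain v where v: "Poly_Mapping.keys v \<subseteq> V" "wt \<delta> D v = wt \<delta> D 0" "v \<noteq> 0"
      using Pc by (auto simp: P_def)
    hence "\<forall>j\<in>V. Poly_Mapping.lookup v j = 0"
      using wt_eq_iff[OF V(1) _ _ D V(2), of v 0] V(1) by simp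
    hence "v = 0" using v(1) by (intro poly_mapping_eqI) (auto simp: in_keys_iff)
    thus False using v by simp
  qed
  moreover have "isolated V (wt \<delta> D) (Poly_Mapping.single i c)"
    unfolding isolated_def
  proof (intro conjI allI impI)
    fix m assume m: "Poly_Mapping.keys m \<subseteq> V" "wt \<delta> D m = wt \<delta> D (Poly_Mapping.single i c)" "m \<noteq> Poly_Mapping.single i c"
    show "Poly_Mapping.keys m \<inter> Poly_Mapping.keys (Poly_Mapping.single i c) = {}"
    proof (rule ccontr)
      assume "\<not> ?thesis"
      hence im: "Poly_Mapping.lookup m i > 0" by (auto split: if_splits simp: in_keys_iff)
      define m' where "m' = m - Poly_Mapping.single i 1"
      have mm': "m = m' + Poly_Mapping.single i 1"
        using im by (intro poly_mapping_eqI) (auto simp: m'_def lookup_add lookup_minus lookup_single when_def)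
      have cc: "Poly_Mapping.single i c = Poly_Mapping.single i (c - 1) + Poly_Mapping.single i 1"
        using \<open>c \<noteq> 0\<close> by (simp add: single_add[symmetric])
      have "P (c - 1)"
        unfolding P_def using m unfolding mm' cc by (auto simp: keys_add_nat wt_add intro!: exI[of _ m'])
      hence "c \<le> c - 1" unfolding c_def by (rule Least_le)
      thus False using \<open>c \<noteq> 0\<close> by simp
    qed
  qed (use i in auto)
  ultimately show ?thesis using Pc by (auto simp: P_def)
qed

text \<open>The critical powers of distinct variables lie in distinct fibres because the ideal is
  homogeneous, so they always count separately; a minimal binomial without pure powers comes on top.\<close>

lemma card_critical_le_card_generators:
  fixes G :: "'k::field mpoly set"
  assumes V: "finite V" "\<And>i. i \<in> V \<Longrightarrow> \<delta> i \<le> D" "inj_on \<delta> V"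
    and lr: "l \<in> V" "r \<in> V" "\<delta> l = 0" "\<delta> r = D"
    and W: "W \<subseteq> V" "\<And>i. i \<in> W \<Longrightarrow> 0 < \<delta> i \<and> \<delta> i < D"
    and D: "D > 0"
    and E: "finite E" "\<And>u. u \<in> E \<Longrightarrow> isolated V (wt \<delta> D) u" "\<And>u. u \<in> E \<Longrightarrow> \<not> pure_power u"
      "\<And>u. u \<in> E \<Longrightarrow> \<exists>v. Poly_Mapping.keys v \<subseteq> V \<and> wt \<delta> D v = wt \<delta> D u \<and> v \<notin> E \<and> \<not> pure_power v"
    and G: "finite G" "G \<subseteq> carrier (mpoly_ring V)" "Idl\<^bsub>mpoly_ring V\<^esub> G = toric_kernel V (wt \<delta> D)"
  shows "card W + card E \<le> card G"
proof -
  have "\<forall>i\<in>W. \<exists>c>0. isolated V (wt \<delta> D) (Poly_Mapping.single i c) \<and>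
    (\<exists>v. Poly_Mapping.keys v \<subseteq> V \<and> wt \<delta> D v = wt \<delta> D (Poly_Mapping.single i c) \<and> v \<noteq> Poly_Mapping.single i c)"
    using critical_exponent[OF V(1,2) lr] W by blast
  then obtain c where c: "\<And>i. i \<in> W \<Longrightarrow> c i > 0"
      "\<And>i. i \<in> W \<Longrightarrow> isolated V (wt \<delta> D) (Poly_Mapping.single i (c i))"
      "\<And>i. i \<in> W \<Longrightarrow> \<exists>v. Poly_Mapping.keys v \<subseteq> V \<and> wt \<delta> D v = wt \<delta> D (Poly_Mapping.single i (c i)) \<and>
        v \<noteq> Poly_Mapping.single i (c i)"
    by (metis (no_types, lifting))
  let ?x = "\<lambda>i. Poly_Mapping.single i (c i)"
  have "finite W" using W V finite_subset by blast
  have inj: "inj_on ?x W"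
    by (rule inj_onI) (metis c(1) lookup_single_eq lookup_single_not_eq less_numeral_extra(3))
  have disj: "?x ` W \<inter> E = {}" using E(3) by (auto simp: pure_power_def)
  have neq: "i = j" if "i \<in> W" "j \<in> W" "wt \<delta> D (?x i) = wt \<delta> D (?x j)" for i j
  proof -
    have "i \<in> V" "j \<in> V" using that W by auto
    hence "c i = c j \<and> c i * \<delta> i = c j * \<delta> j"
      using that by (subst (asm) wt_eq_iff[OF V(1) _ _ D V(2)]) (auto simp: sum_lookup_single V(1))
    hence "\<delta> i = \<delta> j" using c(1)[OF that(1)] by auto
    thus ?thesis using V(3) \<open>i \<in> V\<close> \<open>j \<in> V\<close> by (auto dest: inj_onD)
  qed
  have "card (?x ` W \<union> E) \<le> card G"
  proof (rule card_le_card_generators[OF wt_add _ _ _ G])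
    show "finite (?x ` W \<union> E)" using \<open>finite W\<close> E by simp
    show "isolated V (wt \<delta> D) u" if "u \<in> ?x ` W \<union> E" for u using that E c by auto
    show "\<exists>v. Poly_Mapping.keys v \<subseteq> V \<and> wt \<delta> D v = wt \<delta> D u \<and> v \<notin> ?x ` W \<union> E" if u: "u \<in> ?x ` W \<union> E" for u
    proof -
      have E': "\<exists>v. Poly_Mapping.keys v \<subseteq> V \<and> wt \<delta> D v = wt \<delta> D u \<and> v \<notin> ?x ` W \<union> E" if "u \<in> E" for u
        using E(4)[OF that] by (auto simp: pure_power_def)
      show ?thesis
      proof (cases "u \<in> E")
        case False
        then obtain i where i: "i \<in> W" "u = ?x i" using u by auto
        obtain v where v: "Poly_Mapping.keys v \<subseteq> V" "wt \<delta> D v = wt \<delta> D u" "v \<noteq> u"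
          using c(3)[OF i(1)] i by auto
        show ?thesis
        \<comment> \<open>The partner of a critical power may itself lie in \<open>E\<close>; then
          the partner of that monomial takes its place. Otherwise \<open>neq\<close> keeps it out of
          the critical powers.\<close>
        proof (cases "v \<in> E")
          case True
          thus ?thesis using E'[OF True] v by metis
        next
          case False
          have "v \<notin> ?x ` W" using neq i v by auto
          thus ?thesis using v False by auto
        qed
      qed (rule E')
    qed
  qed
  also have "card (?x ` W \<union> E) = card W + card E"
    using disj E(1) \<open>finite W\<close> by (simp add: card_Un_disjoint card_image[OF inj])
  finally show ?thesis .
qed

section \<open>Lower bounds for projective monomial curves\<close>

lemma Max_image_strict_mono:
  assumes "strict_mono_on {1..n} d" "n \<ge> (1::nat)"
  shows "Max (d ` {1..n}) = (d n :: nat)"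
proof (rule Max_eqI)
  fix y assume "y \<in> d ` {1..n}"
  then obtain i where "i \<in> {1..n}" "y = d i" by auto
  thus "y \<le> d n"
    using strict_mono_on_leD[OF assms(1), of i n] assms(2) by auto
qed (use assms in auto)

text \<open>Provides the numerical hypotheses for \<open>card_critical_le_card_generators\<close>:
  the extreme exponents 0 and \<open>d n\<close> sit at \<open>n + 1\<close> and \<open>n\<close>,
  all others strictly between.\<close>

lemma projective_exponents:
  assumes "strict_mono_on {1..n} d" "n \<ge> (1::nat)" "0 < (d 1 :: nat)"
  shows "inj_on (d(n + 1 := 0)) {1..n + 1}"
    and "\<And>i. i \<in> {1..n + 1} \<Longrightarrow> (d(n + 1 := 0)) i \<le> d n"
    and "\<And>i. i \<in> {1..n - 1} \<Longrightarrow> 0 < d i \<and> d i < d n" and "0 < d n"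
proof -
  have less: "d i < d j" if "1 \<le> i" "i < j" "j \<le> n" for i j
    using that strict_mono_onD[OF assms(1)] by auto
  have pos: "0 < d i" if "1 \<le> i" "i \<le> n" for i
    using that assms(3) less[of 1 i] by (cases "i = 1") auto
  have ne: "d i \<noteq> d j" if "i \<in> {1..n}" "j \<in> {1..n}" "i \<noteq> j" for i j
    using that less[of i j] less[of j i] by (cases "i < j") auto
  show "inj_on (d(n + 1 := 0)) {1..n + 1}"
  proof (rule inj_onI)
    fix i j assume ij: "i \<in> {1..n + 1}" "j \<in> {1..n + 1}" "(d(n + 1 := 0)) i = (d(n + 1 := 0)) j"
    thus "i = j"
      using ne[of i j] pos[of i] pos[of j] by (cases "i = n + 1"; cases "j = n + 1") auto
  qed
  show "(d(n + 1 := 0)) i \<le> d n" if "i \<in> {1..n + 1}" for i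
    using that less[of i n] by (cases "i = n + 1"; cases "i = n") auto
  show "0 < d i \<and> d i < d n" if "i \<in> {1..n - 1}" for i
    using that less[of i n] pos[of i] by auto
  show "0 < d n" using pos[of n] assms(2) by simp
qed

text \<open>The variables 1 to \<open>n - 1\<close> contribute one critical power each. An empty
  \<open>E\<close> yields the bound \<open>n - 1\<close>, a singleton excludes complete
  intersections.\<close>

lemma min_num_generators_ge:
  assumes d: "strict_mono_on {1..n} d" "n \<ge> (1::nat)" "0 < (d 1 :: nat)"
    and E: "finite E" "\<And>u. u \<in> E \<Longrightarrow> isolated {1..n + 1} (wt (d(n + 1 := 0)) (d n)) u"
      "\<And>u. u \<in> E \<Longrightarrow> \<not> pure_power u"
      "\<And>u. u \<in> E \<Longrightarrow> \<exists>v. Poly_Mapping.keys v \<subseteq> {1..n + 1} \<and>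
        wt (d(n + 1 := 0)) (d n) v = wt (d(n + 1 := 0)) (d n) u \<and> v \<notin> E \<and> \<not> pure_power v"
  shows "enat (n - 1 + card E) \<le>
    min_num_generators (mpoly_ring {1..n + 1}) (proj_toric_ideal n d :: 'k::field mpoly set)"
  unfolding min_num_generators_def proj_toric_ideal_eq[OF Max_image_strict_mono[OF d(1,2)]]
proof (rule INF_greatest, clarify)
  fix G :: "'k mpoly set"
  assume G: "finite G" "G \<subseteq> carrier (mpoly_ring {1..n + 1})"
    "Idl\<^bsub>mpoly_ring {1..n + 1}\<^esub> G = toric_kernel {1..n + 1} (wt (d(n + 1 := 0)) (d n))"
  note P = projective_exponents[OF d]
  have "card {1..n - 1} + card E \<le> card G"
    by (rule card_critical_le_card_generators[OF _ P(2) P(1) _ _ _ _ _ _ P(4) E G,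
          where l = "n + 1" and r = n]) (use d(2) P(3) in auto)
  thus "enat (n - 1 + card E) \<le> enat (card G)" by simp
qed

lemma not_complete_intersection:
  assumes d: "strict_mono_on {1..n} d" "n \<ge> (1::nat)" "0 < (d 1 :: nat)"
    and u: "isolated {1..n + 1} (wt (d(n + 1 := 0)) (d n)) u" "\<not> pure_power u"
    and v: "Poly_Mapping.keys v \<subseteq> {1..n + 1}" "\<not> pure_power v" "v \<noteq> u"
      "wt (d(n + 1 := 0)) (d n) v = wt (d(n + 1 := 0)) (d n) u"
  shows "\<not> proj_toric_complete_intersection TYPE('k::field) n d"
proof -
  have "enat (n - 1 + card {u}) \<le>
      min_num_generators (mpoly_ring {1..n + 1}) (proj_toric_ideal n d :: 'k mpoly set)"
    by (rule min_num_generators_ge[OF d]) (use u v in auto)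
  moreover have "enat (n - 1) < enat (n - 1 + card {u})" by simp
  ultimately show ?thesis
    by (auto simp: proj_toric_complete_intersection_def)
qed

lemma single_add_not_pure_power:
  assumes "i \<noteq> j" "a > 0" "b > (0::nat)"
  shows "\<not> pure_power (Poly_Mapping.single i a + Poly_Mapping.single j b)"
proof
  assume "pure_power (Poly_Mapping.single i a + Poly_Mapping.single j b)"
  then obtain k c where eq: "Poly_Mapping.single i a + Poly_Mapping.single j b = Poly_Mapping.single k c"
    by (auto simp: pure_power_def)
  have "i \<in> Poly_Mapping.keys (Poly_Mapping.single k c)" "j \<in> Poly_Mapping.keys (Poly_Mapping.single k c)"
    unfolding eq[symmetric] using assms by (auto simp: keys_add_nat)
  thus False using assms by (auto split: if_splits)
qed

text \<open>A monomial of the fibre containing one of the two factors has a cofactor of degree 1 and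
  prescribed weight; injectivity of \<open>\<delta>\<close> identifies it as the other
  factor.\<close>

lemma isolated_quadratic:
  assumes V: "finite V" "\<And>i. i \<in> V \<Longrightarrow> \<delta> i \<le> D" "inj_on \<delta> V" "D > 0" "i \<in> V" "j \<in> V"
  shows "isolated V (wt \<delta> D) (Poly_Mapping.single i 1 + Poly_Mapping.single j 1)"
  unfolding isolated_def
proof (intro conjI allI impI)
  have *: "m = Poly_Mapping.single i 1 + Poly_Mapping.single j 1"
    if ij: "i \<in> V" "j \<in> V" and m: "Poly_Mapping.keys m \<subseteq> V"
      "wt \<delta> D m = wt \<delta> D (Poly_Mapping.single i 1 + Poly_Mapping.single j 1)" "Poly_Mapping.lookup m i > 0" for i j m
  proof -
    define m' where "m' = m - Poly_Mapping.single i 1"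
    have mm': "m = Poly_Mapping.single i 1 + m'"
      using m(3) by (intro poly_mapping_eqI) (auto simp: m'_def lookup_add lookup_minus lookup_single when_def)
    have k: "Poly_Mapping.keys m' \<subseteq> V" using m(1) by (auto simp: mm' keys_add_nat)
    have "wt \<delta> D m' = wt \<delta> D (Poly_Mapping.single j 1)" using m(2) by (simp add: mm' wt_add)
    hence eq: "(\<Sum>l\<in>V. Poly_Mapping.lookup m' l) = 1" "(\<Sum>l\<in>V. Poly_Mapping.lookup m' l * \<delta> l) = \<delta> j"
      using k ij V by (subst (asm) wt_eq_iff[OF V(1) _ _ V(4,2)]; auto simp: sum_lookup_single)+
    have "\<exists>l\<in>V. Poly_Mapping.lookup m' l \<noteq> 0"
      using eq(1) by (metis sum.neutral zero_neq_one)
    then obtain l where l: "l \<in> V" "Poly_Mapping.lookup m' l \<noteq> 0" by blast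
    \<comment> \<open>Natural numbers with sum 1: the nonzero one equals 1 and the others
      vanish.\<close>
    have split: "Poly_Mapping.lookup m' l + (\<Sum>k\<in>V - {l}. Poly_Mapping.lookup m' k) = 1"
      using eq(1) sum.remove[OF V(1) l(1), of "Poly_Mapping.lookup m'"] by simp
    hence l1: "Poly_Mapping.lookup m' l = 1" "(\<Sum>k\<in>V - {l}. Poly_Mapping.lookup m' k) = 0" using l(2) by linarith+
    have "m' = Poly_Mapping.single l 1"
      using l1 k V(1) by (intro poly_mapping_eqI) (auto simp: lookup_single when_def in_keys_iff)
    moreover from this have "\<delta> l = \<delta> j" using eq(2) l V by (simp add: sum_lookup_single)
    hence "l = j" using V(3) l ij by (auto dest: inj_onD)
    ultimately show ?thesis by (simp add: mm')
  qed
  fix m assume m: "Poly_Mapping.keys m \<subseteq> V"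
    "wt \<delta> D m = wt \<delta> D (Poly_Mapping.single i 1 + Poly_Mapping.single j 1)"
    "m \<noteq> Poly_Mapping.single i 1 + Poly_Mapping.single j 1"
  have "Poly_Mapping.lookup m i = 0"
    using *[OF V(5,6) m(1,2)] m(3) by auto
  moreover have "Poly_Mapping.lookup m j = 0"
    using *[OF V(6,5) m(1)] m(2,3) by (auto simp: add.commute)
  ultimately show "Poly_Mapping.keys m \<inter> Poly_Mapping.keys (Poly_Mapping.single i 1 + Poly_Mapping.single j 1) = {}"
    by (auto simp: in_keys_iff lookup_add lookup_single when_def split: if_splits)
qed (use V in \<open>auto simp: keys_add_nat\<close>)

text \<open>Equal sums of two exponents put two different squarefree quadratic monomials into one
  fibre, and by \<open>isolated_quadratic\<close> one of them counts as an extra isolated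
  monomial.\<close>

lemma quadric_not_complete_intersection:
  assumes d: "strict_mono_on {1..n} d" "n \<ge> (1::nat)" "0 < (d 1 :: nat)"
    and i: "1 \<le> i" "i < j" "j < k" "k < l" "l \<le> n" "d i + d l = d j + d k"
  shows "\<not> proj_toric_complete_intersection TYPE('k::field) n d"
proof -
  let ?u = "Poly_Mapping.single i 1 + Poly_Mapping.single l (1::nat)"
    and ?v = "Poly_Mapping.single j 1 + Poly_Mapping.single k (1::nat)"
  note P = projective_exponents[OF d]
  have "isolated {1..n + 1} (wt (d(n + 1 := 0)) (d n)) ?u"
    by (rule isolated_quadratic[OF _ P(2,1,4)]) (use i in auto)
  moreover have "wt (d(n + 1 := 0)) (d n) ?v = wt (d(n + 1 := 0)) (d n) ?u"
    by (subst wt_eq_iff[where V = "{1..n + 1}", OF _ _ _ P(4,2)])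
      (use i in \<open>auto simp: keys_add_nat lookup_add sum.distrib add_mult_distrib sum_lookup_single simp del: sum.cl_ivl_Suc\<close>)
  moreover have "Poly_Mapping.lookup ?u i \<noteq> Poly_Mapping.lookup ?v i"
    using i by (simp add: lookup_add lookup_single)
  hence "?v \<noteq> ?u" by metis
  ultimately show ?thesis
    using i by (intro not_complete_intersection[OF d _ _ _ _ _, of ?u ?v] single_add_not_pure_power)
      (auto simp: keys_add_nat)
qed

section \<open>Curves of generalized arithmetic sequences that are not complete intersections\<close>

lemma sum_1_4: "(\<Sum>i\<in>{1..4::nat}. f i) = f 1 + f 2 + f 3 + (f 4 :: nat)"
proof -
  have "{1..4} = {1, 2, 3, 4::nat}" by auto
  thus ?thesis by simp
qed

lemma sum_1_5: "(\<Sum>i\<in>{1..5::nat}. f i) = f 1 + f 2 + f 3 + f 4 + (f 5 :: nat)"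
proof -
  have "{1..5} = {1, 2, 3, 4, 5::nat}" by auto
  thus ?thesis by simp
qed

lemma strict_mono_on_3:
  assumes "d 1 < d 2" "d 2 < (d 3 :: nat)"
  shows "strict_mono_on {1..3} (d :: nat \<Rightarrow> nat)"
proof (rule strict_mono_onI)
  fix i j :: nat assume "i \<in> {1..3}" "j \<in> {1..3}" "i < j"
  hence "(i = 1 \<and> j = 2) \<or> (i = 1 \<and> j = 3) \<or> (i = 2 \<and> j = 3)" by auto
  thus "d i < d j" using assms by auto
qed

lemma poly_mapping_eq_1_4I:
  assumes "Poly_Mapping.keys m \<subseteq> {1..4}" "Poly_Mapping.keys m' \<subseteq> {1..4}"
    and "\<And>i. i \<in> {1, 2, 3, 4} \<Longrightarrow> Poly_Mapping.lookup m i = Poly_Mapping.lookup m' (i::nat)"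
  shows "m = m'"
proof (rule poly_mapping_eqI)
  fix i
  show "Poly_Mapping.lookup m i = Poly_Mapping.lookup m' i"
  proof (cases "i \<in> {1..4}")
    case True
    hence "i \<in> {1, 2, 3, 4}" by auto
    thus ?thesis by (rule assms(3))
  next
    case False
    thus ?thesis using assms(1,2) by (metis in_keys_iff subsetD)
  qed
qed

text \<open>Determines the fibre of the monomial with \<open>x0 = e\<close> and
  \<open>x3 = r\<close>: every other member avoids both variables. Coprimality makes the drop
  \<open>P\<close> in \<open>x0\<close> a multiple of \<open>e\<close>, hence 0 or \<open>e\<close>,
  and the parity of \<open>a\<close> settles the second case. Integers are used because differences
  occur.\<close>

lemma odd_fibre_arith:
  fixes a e r x0 x1 x2 x3 :: int
  assumes "a > 0" "e > 0" "coprime a e" "2 * r = a + 1" "x0 \<ge> 0" "x1 \<ge> 0" "x2 \<ge> 0" "x3 \<ge> 0"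
    and deg: "x1 + x2 + x3 + x0 = r + e"
    and wgt: "x1 * a + x2 * (a + e) + x3 * (a + 2 * e) = r * (a + 2 * e)"
  shows "(x0 = e \<and> x1 = 0 \<and> x2 = 0 \<and> x3 = r) \<or> (x0 = 0 \<and> x3 = 0)"
proof -
  define P where "P = e - x0"
  define R where "R = r - x3"
  have x1: "x1 = P + R - x2" using deg by (simp add: P_def R_def)
  have key: "2 * e * R = P * a + x2 * e"
    using wgt x1 by (simp add: R_def algebra_simps)
  \<comment> \<open>The right side is nonnegative, which later rules out a negative quotient
    \<open>Q\<close>.\<close>
  have pos: "P * (a + 2 * e) = e * (2 * x1 + x2)"
    unfolding x1 using key by (simp add: algebra_simps)
  have "e dvd P * a"
  proof
    show "P * a = e * (2 * R - x2)" using key by (simp add: algebra_simps)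
  qed
  hence "e dvd P" using assms(3) by (simp add: coprime_dvd_mult_left_iff coprime_commute)
  then obtain Q where Q: "P = e * Q" by auto
  have "e * (2 * R) = e * (Q * a + x2)" using key Q by (simp add: algebra_simps)
  hence R2: "2 * R = Q * a + x2" using assms(2) by simp
  have "e * (Q * (a + 2 * e)) = e * (2 * x1 + x2)" using pos Q by (simp add: algebra_simps)
  hence Q2: "Q * (a + 2 * e) = 2 * x1 + x2" using assms(2) by simp
  have "Q \<ge> 0"
  proof (rule ccontr)
    assume "\<not> Q \<ge> 0"
    hence "Q * (a + 2 * e) < 0" using assms by (intro mult_neg_pos) auto
    thus False using Q2 assms by simp
  qed
  moreover have "e * Q \<le> e * 1" using Q assms(5) unfolding P_def by linarith
  hence "Q \<le> 1" using assms(2) by simp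
  ultimately consider "Q = 0" | "Q = 1" by linarith
  thus ?thesis
  proof cases
    case 1
    hence "x1 = 0" "x2 = 0" using Q2 assms by auto
    thus ?thesis using 1 Q x1 by (simp add: P_def R_def)
  next
    case 2
    \<comment> \<open>As \<open>a = 2 * r - 1\<close>, the bound \<open>R \<le> r\<close> and parity
      leave only \<open>x2 = 1\<close>, and then \<open>x0\<close> and \<open>x3\<close>
      vanish.\<close>
    hence "2 * R = a + x2" "P = e" using R2 Q by auto
    moreover have "R \<le> r" using assms by (simp add: R_def)
    ultimately have "x2 = 1" "R = r" using assms(4,7) by presburger+
    thus ?thesis using \<open>P = e\<close> by (simp add: P_def R_def)
  qed
qed

text \<open>Oddness makes \<open>r\<close> integral, and \<open>2 * r * e = a * e + e\<close> is
  what gives \<open>?u\<close> and \<open>?v\<close> the same weight. Index 4 is the extra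
  variable.\<close>

lemma arithmetic_odd_not_complete_intersection:
  assumes d: "d 1 = a" "d 2 = a + e" "d 3 = a + 2 * e"
    and a: "odd a" "e > 0" "coprime a (e :: nat)"
  shows "\<not> proj_toric_complete_intersection TYPE('k::field) 3 d"
proof -
  define r where "r = (a + 1) div 2"
  have r: "2 * r = a + 1" using a(1) by (simp add: r_def)
  have "a > 0" using a(1) by (auto intro: Nat.gr0I)
  have mono: "strict_mono_on {1..3} d" using d a(2) by (intro strict_mono_on_3) auto
  have pos: "0 < d 1" using d \<open>a > 0\<close> by simp
  note P = projective_exponents[OF mono _ pos, simplified]
  let ?w = "wt (d(4 := 0)) (d 3)"
  let ?u = "Poly_Mapping.single (4::nat) e + Poly_Mapping.single 3 r"
    and ?v = "Poly_Mapping.single (1::nat) (e + r - 1) + Poly_Mapping.single 2 (1::nat)"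
  have w: "?w m = ?w m' \<longleftrightarrow>
    (\<Sum>i\<in>{1..4}. Poly_Mapping.lookup m i) = (\<Sum>i\<in>{1..4}. Poly_Mapping.lookup m' i) \<and>
    (\<Sum>i\<in>{1..4}. Poly_Mapping.lookup m i * (d(4 := 0)) i) = (\<Sum>i\<in>{1..4}. Poly_Mapping.lookup m' i * (d(4 := 0)) i)"
    if "Poly_Mapping.keys m \<subseteq> {1..4}" "Poly_Mapping.keys m' \<subseteq> {1..4}" for m m'
    using that P(2,4) by (intro wt_eq_iff) auto
  have ku: "Poly_Mapping.keys ?u \<subseteq> {1..4}" and kv: "Poly_Mapping.keys ?v \<subseteq> {1..4}"
    by (auto simp: keys_add_nat)
  have "isolated {1..4} ?w ?u"
    unfolding isolated_def
  proof (intro conjI allI impI ku)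
    fix m assume m: "Poly_Mapping.keys m \<subseteq> {1..4}" "?w m = ?w ?u" "m \<noteq> ?u"
    define x where "x i = int (Poly_Mapping.lookup m i)" for i
    have "Poly_Mapping.lookup m 1 + Poly_Mapping.lookup m 2 + Poly_Mapping.lookup m 3 + Poly_Mapping.lookup m 4 = r + e"
      and "Poly_Mapping.lookup m 1 * a + Poly_Mapping.lookup m 2 * (a + e) + Poly_Mapping.lookup m 3 * (a + 2 * e) = r * (a + 2 * e)"
      using m(2) unfolding w[OF m(1) ku] sum_1_4
      by (auto simp: lookup_add lookup_single d d(1)[unfolded One_nat_def])
    from this[THEN arg_cong[of _ _ int]]
    have "x 1 + x 2 + x 3 + x 4 = int r + int e"
      "x 1 * int a + x 2 * (int a + int e) + x 3 * (int a + 2 * int e) = int r * (int a + 2 * int e)"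
      by (simp_all add: x_def)
    hence "(x 4 = int e \<and> x 1 = 0 \<and> x 2 = 0 \<and> x 3 = int r) \<or> (x 4 = 0 \<and> x 3 = 0)"
      using a(2,3) \<open>a > 0\<close> r by (intro odd_fibre_arith[of "int a"]) (auto simp: x_def)
    moreover have "\<not> (x 4 = int e \<and> x 1 = 0 \<and> x 2 = 0 \<and> x 3 = int r)"
    proof
      assume "x 4 = int e \<and> x 1 = 0 \<and> x 2 = 0 \<and> x 3 = int r"
      hence "m = ?u" using m(1) ku
        by (intro poly_mapping_eq_1_4I) (auto simp: x_def lookup_add lookup_single)
      thus False using m(3) by simp
    qed
    ultimately show "Poly_Mapping.keys m \<inter> Poly_Mapping.keys ?u = {}"
      by (auto simp: x_def in_keys_iff lookup_add lookup_single when_def split: if_splits)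
  qed
  moreover have "?w ?v = ?w ?u"
  proof -
    \<comment> \<open>Removes the truncated subtraction in \<open>e + r - 1\<close>.\<close>
    obtain r' where r': "r = Suc r'" using r by (cases r) auto
    have "a = 2 * r' + 1" using r r' by simp
    thus ?thesis unfolding w[OF kv ku] sum_1_4 using r'
      by (simp add: lookup_add lookup_single d d(1)[unfolded One_nat_def] algebra_simps)
  qed
  moreover have "Poly_Mapping.lookup ?v 2 \<noteq> Poly_Mapping.lookup ?u 2"
    by (simp add: lookup_add lookup_single)
  hence "?v \<noteq> ?u" by metis
  moreover have "\<not> pure_power ?u" "\<not> pure_power ?v"
    using a(2) r by (intro single_add_not_pure_power; simp)+
  ultimately show ?thesis
    using kv by (intro not_complete_intersection[OF mono _ pos, of ?u ?v]) auto
qed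

text \<open>The case \<open>d 1 = 1\<close>. The weight is too small for \<open>x4 \<ge> 1\<close>,
  \<open>x3 \<ge> 2\<close> or \<open>x2 \<ge> 2\<close>; with \<open>x2 = x3 = 0\<close> it would
  need more factors \<open>x1\<close> than the degree allows.\<close>

lemma unit_fibre_arith:
  fixes h e x0 x1 x2 x3 x4 :: nat
  assumes "e > 0" "h > 0" and deg: "x1 + x2 + x3 + x4 + x0 = e + 1"
    and wgt: "x1 + x2 * (h + e) + x3 * (h + 2 * e) + x4 * (h + 3 * e) = h + 2 * e"
  shows "x4 = 0 \<and> ((x1 = e \<and> x2 = 1 \<and> x3 = 0 \<and> x0 = 0) \<or> (x1 = 0 \<and> x2 = 0 \<and> x3 = 1 \<and> x0 = e))"
proof -
  \<comment> \<open>Naming the products leaves their lower bounds as the only nonlinear input to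
    linear arithmetic.\<close>
  define A2 A3 A4 where A: "A2 = x2 * (h + e)" "A3 = x3 * (h + 2 * e)" "A4 = x4 * (h + 3 * e)"
  have sum: "x1 + A2 + A3 + A4 = h + 2 * e" using wgt by (simp add: A)
  have A2: "k * (h + e) \<le> A2" if "k \<le> x2" for k using that unfolding A by (rule mult_le_mono1)
  have A3: "k * (h + 2 * e) \<le> A3" if "k \<le> x3" for k using that unfolding A by (rule mult_le_mono1)
  have A4: "k * (h + 3 * e) \<le> A4" if "k \<le> x4" for k using that unfolding A by (rule mult_le_mono1)
  have x4: "x4 = 0" using A4[of 1] sum assms(1) by (cases "x4 = 0") auto
  have "x3 \<le> 1" using A3[of 2] sum assms(1) by (cases "x3 \<le> 1") auto
  moreover have "x2 \<le> 1" using A2[of 2] sum assms(2) by (cases "x2 \<le> 1") auto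
  ultimately consider "x3 = 1" | "x3 = 0" "x2 = 1" | "x3 = 0" "x2 = 0" by linarith
  thus ?thesis
  proof cases
    case 1
    hence "x1 = 0" "A2 = 0" using sum A3[of 1] by auto
    moreover from this have "x2 = 0" using assms(1) by (simp add: A)
    ultimately show ?thesis using 1 x4 deg by simp
  next
    case 2
    thus ?thesis using wgt deg x4 by simp
  next
    case 3
    thus ?thesis using wgt deg x4 assms by simp
  qed
qed

text \<open>The weight bounds \<open>x2\<close>, \<open>x3\<close> and \<open>x4\<close>. A factor
  \<open>x4\<close> would leave an equation forcing \<open>a\<close> to divide \<open>e\<close>; in
  the surviving cases degree and weight fix the rest.\<close>

lemma nonunit_fibre_arith:
  fixes a h e x0 x1 x2 x3 x4 :: nat
  assumes "a > 0" "e > 0" "h > 0" "\<not> a dvd e" and deg: "x1 + x2 + x3 + x4 + x0 = h + 1"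
    and wgt: "x1 * a + x2 * (h * a + e) + x3 * (h * a + 2 * e) + x4 * (h * a + 3 * e) = 2 * (h * a) + 2 * e"
  shows "x4 = 0 \<and> ((x1 = h \<and> x2 = 0 \<and> x3 = 1 \<and> x0 = 0) \<or> (x1 = 0 \<and> x2 = 2 \<and> x3 = 0 \<and> x0 = h - 1))"
proof -
  define H A1 A2 A3 A4 where A: "H = h * a" "A1 = x1 * a" "A2 = x2 * (h * a + e)"
    "A3 = x3 * (h * a + 2 * e)" "A4 = x4 * (h * a + 3 * e)"
  have sum: "A1 + A2 + A3 + A4 = 2 * H + 2 * e" using wgt by (simp add: A)
  have A1: "A1 \<le> k * a" if "x1 \<le> k" for k using that unfolding A by (rule mult_le_mono1)
  have A2: "k * (H + e) \<le> A2" if "k \<le> x2" for k using that unfolding A by (rule mult_le_mono1)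
  have A3: "k * (H + 2 * e) \<le> A3" if "k \<le> x3" for k using that unfolding A by (rule mult_le_mono1)
  have A4: "k * (H + 3 * e) \<le> A4" if "k \<le> x4" for k using that unfolding A by (rule mult_le_mono1)
  have H: "H > 0" using assms by (simp add: A)
  have "x4 \<le> 1" using A4[of 2] sum assms(2) by (cases "x4 \<le> 1") auto
  have "x3 \<le> 1" using A3[of 2] sum assms(2) by (cases "x3 \<le> 1") auto
  have "x2 \<le> 2" using A2[of 3] sum H by (cases "x2 \<le> 2") auto
  have x4: "x4 = 0"
  proof (rule ccontr)
    assume "x4 \<noteq> 0"
    hence x4: "x4 = 1" using \<open>x4 \<le> 1\<close> by simp
    have "x3 = 0" using A3[of 1] A4[of 1] x4 sum assms(2) by (cases "x3 = 0") auto
    moreover have "x2 = 0" using A2[of 1] A4[of 1] x4 sum assms(2) by (cases "x2 = 0") auto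
    ultimately have "x1 * a + e = h * a" using wgt x4 by (simp add: algebra_simps)
    hence "a dvd e" by (metis dvd_add_right_iff dvd_triv_right)
    thus False using assms(4) by simp
  qed
  consider "x3 = 1" | "x3 = 0" "x2 = 0" | "x3 = 0" "x2 = 1" | "x3 = 0" "x2 = 2"
    using \<open>x3 \<le> 1\<close> \<open>x2 \<le> 2\<close> by linarith
  thus ?thesis
  proof cases
    case 1
    have x2: "x2 = 0" using A2[of 1] A3[of 1] 1 sum assms(2) by (cases "x2 = 0") auto
    hence "x1 * a = h * a" using wgt x4 1 by auto
    hence "x1 = h" using assms(1) by simp
    thus ?thesis using 1 x2 x4 deg by simp
  next
    case 2
    \<comment> \<open>The degree gives \<open>x1 \<le> h + 1 \<le> 2 * h\<close>, so the weight
      falls short by at least \<open>2 * e\<close>.\<close>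
    hence "A1 \<le> 2 * H" using A1[of "2 * h"] deg assms(3) by (simp add: A(1))
    thus ?thesis using sum 2 x4 assms(2) by (simp add: A(3-5))
  next
    case 3
    hence "A1 \<le> H" using A1[of h] deg by (simp add: A(1))
    thus ?thesis using sum 3 x4 assms(2) by (simp add: A(3-5) flip: A(1))
  next
    case 4
    hence "x1 = 0" using wgt x4 assms(1) by simp
    thus ?thesis using 4 x4 deg by simp
  qed
qed

lemma generalized_not_complete_intersection:
  assumes n: "n = 3 \<or> n = (4::nat)" and mono: "strict_mono_on {1..n} d"
    and d: "d 1 = a" "d 2 = h * a + e" "d 3 = h * a + 2 * e" "n = 4 \<Longrightarrow> d 4 = h * a + 3 * e"
    and a: "a > 0" "e > 0" "h \<ge> 2" "coprime a (e :: nat)"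
  shows "\<not> proj_toric_complete_intersection TYPE('k::field) n d"
proof -
  have pos: "0 < d 1" and n1: "1 \<le> n" using d a n by auto
  note P = projective_exponents[OF mono n1 pos]
  let ?w = "wt (d(n + 1 := 0)) (d n)"
  \<comment> \<open>For \<open>n = 3\<close> index 4 is the extra variable, so the exponent of a
    fourth sequence term is set to 0 and both values of \<open>n\<close> share the same
    equations.\<close>
  define x4 where "x4 m = (if n = 4 then Poly_Mapping.lookup m 4 else 0)" for m :: "nat \<Rightarrow>\<^sub>0 nat"
  have sum: "(\<Sum>i\<in>{1..n + 1}. f i) = f 1 + f 2 + f 3 + (if n = 4 then f 4 else 0) + (f (n + 1) :: nat)" for f
    using n
  proof
    assume "n = 3"
    thus ?thesis using sum_1_4[of f] by simp
  next
    assume "n = 4"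
    thus ?thesis using sum_1_5[of f] by simp
  qed
  have w: "?w m = ?w m' \<longleftrightarrow>
     Poly_Mapping.lookup m 1 + Poly_Mapping.lookup m 2 + Poly_Mapping.lookup m 3 + x4 m + Poly_Mapping.lookup m (n + 1) =
     Poly_Mapping.lookup m' 1 + Poly_Mapping.lookup m' 2 + Poly_Mapping.lookup m' 3 + x4 m' + Poly_Mapping.lookup m' (n + 1) \<and>
     Poly_Mapping.lookup m 1 * a + Poly_Mapping.lookup m 2 * (h * a + e) + Poly_Mapping.lookup m 3 * (h * a + 2 * e) + x4 m * (h * a + 3 * e) =
     Poly_Mapping.lookup m' 1 * a + Poly_Mapping.lookup m' 2 * (h * a + e) + Poly_Mapping.lookup m' 3 * (h * a + 2 * e) + x4 m' * (h * a + 3 * e)"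
    if "Poly_Mapping.keys m \<subseteq> {1..n + 1}" "Poly_Mapping.keys m' \<subseteq> {1..n + 1}" for m m'
    using wt_eq_iff[of "{1..n + 1}" m m' "d n" "d(n + 1 := 0)", OF finite_atLeastAtMost that P(4,2), unfolded sum] n
    by (auto simp: x4_def d d(1)[unfolded One_nat_def])
  have eqI: "m = m'"
    if "Poly_Mapping.keys m \<subseteq> {1..n + 1}" "Poly_Mapping.keys m' \<subseteq> {1..n + 1}"
      and eq: "Poly_Mapping.lookup m 1 = Poly_Mapping.lookup m' 1" "Poly_Mapping.lookup m 2 = Poly_Mapping.lookup m' 2"
       "Poly_Mapping.lookup m 3 = Poly_Mapping.lookup m' 3" "x4 m = x4 m'"
       "Poly_Mapping.lookup m (n + 1) = Poly_Mapping.lookup m' (n + 1)" for m m'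
  proof (rule poly_mapping_eqI)
    fix i
    show "Poly_Mapping.lookup m i = Poly_Mapping.lookup m' i"
    proof (cases "i \<in> {1..n + 1}")
      case True
      hence "i = 1 \<or> i = 2 \<or> i = 3 \<or> (n = 4 \<and> i = 4) \<or> i = n + 1" using n by auto
      thus ?thesis using eq by (auto simp: x4_def)
    next
      case False
      thus ?thesis using that(1,2) by (metis in_keys_iff subsetD)
    qed
  qed
  show ?thesis
  \<comment> \<open>For \<open>a > 1\<close> coprimality gives that \<open>a\<close> does not divide
    \<open>e\<close>, as \<open>nonunit_fibre_arith\<close> requires; \<open>a = 1\<close> needs
    another monomial.\<close>
  proof (cases "a = 1")
    case True
    let ?u = "Poly_Mapping.single (1::nat) e + Poly_Mapping.single 2 (1::nat)"
      and ?v = "Poly_Mapping.single (n + 1) e + Poly_Mapping.single 3 (1::nat)"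
    have ku: "Poly_Mapping.keys ?u \<subseteq> {1..n + 1}" and kv: "Poly_Mapping.keys ?v \<subseteq> {1..n + 1}"
      using n by (auto simp: keys_add_nat)
    have uv: "m = ?u \<or> m = ?v" if m: "Poly_Mapping.keys m \<subseteq> {1..n + 1}" "?w m = ?w ?u" for m
    proof -
      let ?x = "\<lambda>i. Poly_Mapping.lookup m i"
      have deg: "?x 1 + ?x 2 + ?x 3 + x4 m + ?x (n + 1) = e + 1"
        and wgt: "?x 1 + ?x 2 * (h + e) + ?x 3 * (h + 2 * e) + x4 m * (h + 3 * e) = h + 2 * e"
        using m(2) n True unfolding w[OF m(1) ku]
        by (auto simp: x4_def lookup_add lookup_single)
      note F = unit_fibre_arith[OF a(2) _ deg wgt]
      have "x4 m = 0" using F a(3) by auto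
      have "(?x 1 = e \<and> ?x 2 = 1 \<and> ?x 3 = 0 \<and> ?x (n + 1) = 0) \<or>
          (?x 1 = 0 \<and> ?x 2 = 0 \<and> ?x 3 = 1 \<and> ?x (n + 1) = e)"
        using F a(3) by auto
      thus ?thesis
      proof
        assume "?x 1 = e \<and> ?x 2 = 1 \<and> ?x 3 = 0 \<and> ?x (n + 1) = 0"
        hence "m = ?u"
          using m(1) ku \<open>x4 m = 0\<close> n by (intro eqI) (auto simp: x4_def lookup_add lookup_single)
        thus ?thesis ..
      next
        assume "?x 1 = 0 \<and> ?x 2 = 0 \<and> ?x 3 = 1 \<and> ?x (n + 1) = e"
        hence "m = ?v"
          using m(1) kv \<open>x4 m = 0\<close> n by (intro eqI) (auto simp: x4_def lookup_add lookup_single)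
        thus ?thesis ..
      qed
    qed
    have "isolated {1..n + 1} ?w ?u"
      unfolding isolated_def
    proof (intro conjI allI impI ku)
      fix m assume "Poly_Mapping.keys m \<subseteq> {1..n + 1}" "?w m = ?w ?u" "m \<noteq> ?u"
      hence "m = ?v" using uv[of m] by blast
      thus "Poly_Mapping.keys m \<inter> Poly_Mapping.keys ?u = {}"
        using n by (auto simp: keys_add_nat split: if_splits)
    qed
    moreover have "?w ?v = ?w ?u"
      unfolding w[OF kv ku] using True n by (auto simp: x4_def lookup_add lookup_single)
    moreover have "Poly_Mapping.lookup ?v 2 \<noteq> Poly_Mapping.lookup ?u 2"
      using n by (auto simp: lookup_add lookup_single)
    hence "?v \<noteq> ?u" by metis
    moreover have "\<not> pure_power ?u" "\<not> pure_power ?v"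
      using a n by (intro single_add_not_pure_power; auto)+
    ultimately show ?thesis
      using kv by (intro not_complete_intersection[OF mono n1 pos, of ?u ?v]) auto
  next
    case False
    \<comment> \<open>Here \<open>h \<ge> 2\<close> keeps \<open>h - 1\<close> positive, so that
      \<open>?v\<close> is not a pure power.\<close>
    let ?u = "Poly_Mapping.single (1::nat) h + Poly_Mapping.single 3 (1::nat)"
      and ?v = "Poly_Mapping.single (n + 1) (h - 1) + Poly_Mapping.single 2 (2::nat)"
    have ku: "Poly_Mapping.keys ?u \<subseteq> {1..n + 1}" and kv: "Poly_Mapping.keys ?v \<subseteq> {1..n + 1}"
      using n by (auto simp: keys_add_nat)
    have uv: "m = ?u \<or> m = ?v" if m: "Poly_Mapping.keys m \<subseteq> {1..n + 1}" "?w m = ?w ?u" for m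
    proof -
      let ?x = "\<lambda>i. Poly_Mapping.lookup m i"
      have deg: "?x 1 + ?x 2 + ?x 3 + x4 m + ?x (n + 1) = h + 1"
        and wgt: "?x 1 * a + ?x 2 * (h * a + e) + ?x 3 * (h * a + 2 * e) + x4 m * (h * a + 3 * e) = 2 * (h * a) + 2 * e"
        using m(2) n unfolding w[OF m(1) ku]
        by (auto simp: x4_def lookup_add lookup_single)
      have "\<not> a dvd e"
        using a(4) False by (metis coprime_absorb_left nat_dvd_1_iff_1 One_nat_def)
      note F = nonunit_fibre_arith[OF a(1,2) _ this deg wgt]
      have x4: "x4 m = 0" using F a(3) by auto
      have "(?x 1 = h \<and> ?x 2 = 0 \<and> ?x 3 = 1 \<and> ?x (n + 1) = 0) \<or>
          (?x 1 = 0 \<and> ?x 2 = 2 \<and> ?x 3 = 0 \<and> ?x (n + 1) = h - 1)"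
        using F a(3) by auto
      thus ?thesis
      proof
        assume "?x 1 = h \<and> ?x 2 = 0 \<and> ?x 3 = 1 \<and> ?x (n + 1) = 0"
        hence "m = ?u"
          using m(1) ku x4 n by (intro eqI) (auto simp: x4_def lookup_add lookup_single)
        thus ?thesis ..
      next
        assume "?x 1 = 0 \<and> ?x 2 = 2 \<and> ?x 3 = 0 \<and> ?x (n + 1) = h - 1"
        hence "m = ?v"
          using m(1) kv x4 n by (intro eqI) (auto simp: x4_def lookup_add lookup_single)
        thus ?thesis ..
      qed
    qed
    have "isolated {1..n + 1} ?w ?u"
      unfolding isolated_def
    proof (intro conjI allI impI ku)
      fix m assume "Poly_Mapping.keys m \<subseteq> {1..n + 1}" "?w m = ?w ?u" "m \<noteq> ?u"
      hence "m = ?v" using uv[of m] by blast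
      thus "Poly_Mapping.keys m \<inter> Poly_Mapping.keys ?u = {}"
        using n by (auto simp: keys_add_nat split: if_splits)
    qed
    moreover have "?w ?v = ?w ?u"
      unfolding w[OF kv ku] using n a(3) by (auto simp: x4_def lookup_add lookup_single)
    moreover have "Poly_Mapping.lookup ?v 2 \<noteq> Poly_Mapping.lookup ?u 2"
      using n by (auto simp: lookup_add lookup_single)
    hence "?v \<noteq> ?u" by metis
    moreover have "\<not> pure_power ?u" "\<not> pure_power ?v"
      using a n by (intro single_add_not_pure_power; auto)+
    ultimately show ?thesis
      using kv by (intro not_complete_intersection[OF mono n1 pos, of ?u ?v]) auto
  qed
qed

section \<open>The complete intersection case\<close>

lemma mpoly_idealD:
  fixes J :: "'k::field mpoly set"
  assumes "ideal J (mpoly_ring V)"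
  shows "0 \<in> J" and "\<And>p. p \<in> J \<Longrightarrow> p \<in> carrier (mpoly_ring V)"
    and "\<And>p q. p \<in> J \<Longrightarrow> q \<in> J \<Longrightarrow> p + q \<in> J"
    and "\<And>p r. p \<in> J \<Longrightarrow> r \<in> carrier (mpoly_ring V) \<Longrightarrow> r * p \<in> J"
  using ideal.I_l_closed[OF assms] ideal.axioms(1)[OF assms]
    additive_subgroup.a_closed additive_subgroup.zero_closed additive_subgroup.a_Hcarr
  by fastforce+

text \<open>Replacing each monomial of \<open>p\<close> by a representative of its fibre changes
  \<open>p\<close> by a combination of binomials. The replaced polynomial is zero because the
  coefficients cancel fibrewise.\<close>

lemma toric_kernel_subset_ideal:
  fixes J :: "'k::field mpoly set"
  assumes J: "ideal J (mpoly_ring V)"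
    and bin: "\<And>m m'. Poly_Mapping.keys m \<subseteq> V \<Longrightarrow> Poly_Mapping.keys m' \<subseteq> V \<Longrightarrow> w m = w m' \<Longrightarrow>
      Poly_Mapping.single m 1 - Poly_Mapping.single m' 1 \<in> J"
  shows "toric_kernel V w \<subseteq> J"
proof
  fix p :: "'k mpoly" assume p: "p \<in> toric_kernel V w"
  note D = mpoly_idealD[OF J]
  define \<rho> where "\<rho> s = (SOME m. Poly_Mapping.keys m \<subseteq> V \<and> w m = s)" for s
  have rho: "Poly_Mapping.keys (\<rho> (w m)) \<subseteq> V \<and> w (\<rho> (w m)) = w m" if "Poly_Mapping.keys m \<subseteq> V" for m
    unfolding \<rho>_def by (rule someI[of _ m]) (use that in simp)
  \<comment> \<open>The replacement factors through \<open>push w p\<close>, which vanishes.\<close>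
  have "(\<Sum>m\<in>Poly_Mapping.keys p. Poly_Mapping.single (\<rho> (w m)) (Poly_Mapping.lookup p m)) = push \<rho> (push w p)"
    unfolding push_def[of w p] push_sum by simp
  also have "\<dots> = 0" using p by (simp add: toric_kernel_def)
  finally have "p = (\<Sum>m\<in>Poly_Mapping.keys p. Poly_Mapping.single m (Poly_Mapping.lookup p m)) -
      (\<Sum>m\<in>Poly_Mapping.keys p. Poly_Mapping.single (\<rho> (w m)) (Poly_Mapping.lookup p m))"
    by (simp add: sum_single_keys)
  also have "\<dots> = (\<Sum>m\<in>Poly_Mapping.keys p. mconst (Poly_Mapping.lookup p m) *
      (Poly_Mapping.single m 1 - Poly_Mapping.single (\<rho> (w m)) 1))"
    by (simp add: sum_subtractf[symmetric] mconst_def right_diff_distrib mult_single)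
  finally have p_eq: "p = \<dots>" .
  have "(\<Sum>m\<in>A. mconst (Poly_Mapping.lookup p m) *
      (Poly_Mapping.single m 1 - Poly_Mapping.single (\<rho> (w m)) 1)) \<in> J"
    if "finite A" "A \<subseteq> Poly_Mapping.keys p" for A
    using that
  proof (induction A rule: finite_induct)
    case (insert m A)
    have "Poly_Mapping.keys m \<subseteq> V"
      using insert.prems p by (auto simp: toric_kernel_def mem_carrier_mpoly_ring)
    hence "Poly_Mapping.single m 1 - Poly_Mapping.single (\<rho> (w m)) 1 \<in> J"
      using rho[of m] by (intro bin) auto
    hence "mconst (Poly_Mapping.lookup p m) * (Poly_Mapping.single m 1 - Poly_Mapping.single (\<rho> (w m)) 1) \<in> J"
      by (rule D(4)) (simp add: mconst_def)
    thus ?case using insert D(3) by simp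
  qed (use D in simp)
  from this[OF finite_keys order_refl] show "p \<in> J" using p_eq by simp
qed

section \<open>Monomials in four variables and normal forms for even first term\<close>

definition mon4 :: "nat \<Rightarrow> nat \<Rightarrow> nat \<Rightarrow> nat \<Rightarrow> (nat \<Rightarrow>\<^sub>0 nat)" where
  "mon4 \<alpha> \<beta> \<gamma> \<delta> = Poly_Mapping.single 1 \<alpha> + Poly_Mapping.single 2 \<beta> +
     Poly_Mapping.single 3 \<gamma> + Poly_Mapping.single 4 \<delta>"

lemma keys_mon4: "Poly_Mapping.keys (mon4 \<alpha> \<beta> \<gamma> \<delta>) \<subseteq> {1..4}"
  by (auto simp: mon4_def keys_add_nat)

lemma mon4_add: "mon4 \<alpha> \<beta> \<gamma> \<delta> + mon4 \<alpha>' \<beta>' \<gamma>' \<delta>' = mon4 (\<alpha> + \<alpha>') (\<beta> + \<beta>') (\<gamma> + \<gamma>') (\<delta> + \<delta>')"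
  by (simp add: mon4_def single_add ac_simps)

lemma mon4_cases:
  assumes "Poly_Mapping.keys m \<subseteq> {1..4}"
  obtains \<alpha> \<beta> \<gamma> \<delta> where "m = mon4 \<alpha> \<beta> \<gamma> \<delta>"
proof
  show "m = mon4 (Poly_Mapping.lookup m 1) (Poly_Mapping.lookup m 2) (Poly_Mapping.lookup m 3) (Poly_Mapping.lookup m 4)"
    by (rule poly_mapping_eq_1_4I[OF assms keys_mon4]) (auto simp: mon4_def lookup_add lookup_single)
qed

lemma wt_mon4_eq_iff:
  assumes "0 < D" "\<And>i. i \<in> {1..4} \<Longrightarrow> \<delta> i \<le> D"
  shows "wt \<delta> D (mon4 x1 x2 x3 x4) = wt \<delta> D (mon4 y1 y2 y3 y4) \<longleftrightarrow>
    x1 + x2 + x3 + x4 = y1 + y2 + y3 + y4 \<and>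
    x1 * \<delta> 1 + x2 * \<delta> 2 + x3 * \<delta> 3 + x4 * \<delta> 4 = y1 * \<delta> 1 + y2 * \<delta> 2 + y3 * \<delta> 3 + y4 * \<delta> 4"
  by (subst wt_eq_iff[OF finite_atLeastAtMost keys_mon4 keys_mon4 assms], assumption)
    (simp only: sum_1_4, simp add: mon4_def lookup_add lookup_single)

text \<open>As \<open>e\<close> is odd, the parity of the weight determines \<open>x2\<close>. Half
  of the rest, modulo \<open>a + e\<close>, determines \<open>x1\<close> below \<open>a + e\<close>
  because \<open>a\<close> is prime to \<open>a + e\<close>; then \<open>x3\<close> follows.\<close>

lemma even_normal_form_unique:
  fixes a e x1 x2 x3 y1 y2 y3 :: nat
  assumes "odd e" "coprime a e" "x1 < a + e" "y1 < a + e" "x2 < 2" "y2 < 2"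
    and eq: "x1 * (2 * a) + x2 * (2 * a + e) + x3 * (2 * a + 2 * e) =
      y1 * (2 * a) + y2 * (2 * a + e) + y3 * (2 * a + 2 * e)"
  shows "x1 = y1 \<and> x2 = y2 \<and> x3 = y3"
proof -
  have "even (x1 * (2 * a) + x2 * (2 * a + e) + x3 * (2 * a + 2 * e)) \<longleftrightarrow> even x2"
    "even (y1 * (2 * a) + y2 * (2 * a + e) + y3 * (2 * a + 2 * e)) \<longleftrightarrow> even y2"
    using assms(1) by simp_all
  hence "even x2 \<longleftrightarrow> even y2" using eq by simp
  moreover have "x2 = 0 \<or> x2 = 1" "y2 = 0 \<or> y2 = 1" using assms(5,6) by auto
  ultimately have x2: "x2 = y2" by auto
  hence "2 * (x1 * a + x3 * (a + e)) = 2 * (y1 * a + y3 * (a + e))"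
    using eq by (simp add: algebra_simps)
  hence eq': "x1 * a + x3 * (a + e) = y1 * a + y3 * (a + e)" by simp
  have pos: "a + e > 0" using assms(3) by linarith
  have "(int x1 - int y1) * int a = int (a + e) * (int y3 - int x3)"
    using arg_cong[OF eq', of int] by (simp add: algebra_simps)
  hence "int (a + e) dvd (int x1 - int y1) * int a" by simp
  moreover have "coprime (int (a + e)) (int a)"
    unfolding coprime_int_iff using assms(2)
    by (metis add.commute coprime_iff_gcd_eq_1 gcd.commute gcd_add1)
  ultimately have "int (a + e) dvd int x1 - int y1"
    by (simp only: coprime_dvd_mult_left_iff)
  hence "int x1 - int y1 = 0"
    using dvd_imp_le_int[of "int x1 - int y1" "int (a + e)"] assms(3,4) by (cases "int x1 - int y1 = 0") auto
  hence x1: "x1 = y1" by simp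
  hence "x3 * (a + e) = y3 * (a + e)" using eq' by simp
  hence "x3 = y3" using pos by (metis mult_cancel2 less_not_refl)
  thus ?thesis using x1 x2 by simp
qed

lemma arithmetic_even_min_num_generators_le:
  assumes d: "d 1 = 2 * a" "d 2 = 2 * a + e" "d 3 = 2 * a + 2 * e"
    and a: "odd e" "coprime a e" "a > (0::nat)"
  shows "min_num_generators (mpoly_ring {1..3 + 1}) (proj_toric_ideal 3 d :: 'k::field mpoly set) \<le> enat 2"
proof -
  have "e > 0" using a(1) by (auto intro: Nat.gr0I)
  have mono: "strict_mono_on {1..3} d" using d \<open>e > 0\<close> by (intro strict_mono_on_3) auto
  have pos: "0 < d 1" using d a by simp
  note P = projective_exponents[OF mono _ pos, simplified]
  let ?w = "wt (d(4 := 0)) (d 3)"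
  let ?R = "mpoly_ring {1..4} :: 'k mpoly ring"
  interpret R: cring ?R by (rule cring_mpoly_ring)
  have I: "proj_toric_ideal 3 d = (toric_kernel {1..4} ?w :: 'k mpoly set)"
    using proj_toric_ideal_eq[OF Max_image_strict_mono[OF mono]] by simp
  have w: "?w (mon4 x1 x2 x3 x4) = ?w (mon4 y1 y2 y3 y4) \<longleftrightarrow>
    x1 + x2 + x3 + x4 = y1 + y2 + y3 + y4 \<and>
    x1 * (2 * a) + x2 * (2 * a + e) + x3 * (2 * a + 2 * e) = y1 * (2 * a) + y2 * (2 * a + e) + y3 * (2 * a + 2 * e)"
    for x1 x2 x3 x4 y1 y2 y3 y4
    using wt_mon4_eq_iff[of "d 3" "d(4 := 0)" x1 x2 x3 x4 y1 y2 y3 y4] P(2,4) d d(1)[unfolded One_nat_def]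
    by simp
  define bin :: "(nat \<Rightarrow>\<^sub>0 nat) \<Rightarrow> (nat \<Rightarrow>\<^sub>0 nat) \<Rightarrow> 'k mpoly"
    where "bin u v = Poly_Mapping.single u 1 - Poly_Mapping.single v 1" for u v
  let ?f = "bin (mon4 0 2 0 0) (mon4 1 0 1 0)"
    and ?g = "bin (mon4 (a + e) 0 0 0) (mon4 0 0 a e)"
  define J where "J = Idl\<^bsub>?R\<^esub> {?f, ?g}"
  have bin_carrier: "bin (mon4 x1 x2 x3 x4) (mon4 y1 y2 y3 y4) \<in> carrier ?R" for x1 x2 x3 x4 y1 y2 y3 y4
    unfolding bin_def by (intro mpoly_ring_diff_closed mpoly_ring_single keys_mon4)
  have J: "ideal J ?R" unfolding J_def by (rule R.genideal_ideal) (use bin_carrier in auto)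
  note JD = mpoly_idealD[OF J]
  have gens: "?f \<in> J" "?g \<in> J"
    using R.genideal_self[of "{?f, ?g}"] bin_carrier by (auto simp: J_def)
  have "?f \<in> toric_kernel {1..4} ?w"
    unfolding bin_def by (rule binomial_mem_toric_kernel[OF keys_mon4 keys_mon4]) (simp add: w)
  moreover have "?g \<in> toric_kernel {1..4} ?w"
    unfolding bin_def by (rule binomial_mem_toric_kernel[OF keys_mon4 keys_mon4]) (simp add: w algebra_simps)
  ultimately have sub: "J \<subseteq> toric_kernel {1..4} ?w"
    unfolding J_def by (intro R.genideal_minimal ideal_toric_kernel wt_add) auto
  have trans: "bin u v \<in> J" if "bin u t \<in> J" "bin t v \<in> J" for u t v
    using JD(3)[OF that] by (simp add: bin_def)
  have sym: "bin v u \<in> J" if "bin u v \<in> J" for u v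
    using JD(4)[OF that, of "- 1"] by (simp add: bin_def)
  have shift: "bin (mon4 x1 x2 x3 x4 + u) (mon4 x1 x2 x3 x4 + v) \<in> J" if "bin u v \<in> J" for u v x1 x2 x3 x4
    using JD(4)[OF that mpoly_ring_single[OF keys_mon4, of x1 x2 x3 x4 1]]
    by (simp add: bin_def right_diff_distrib mult_single)
  have red_f: "bin (mon4 \<alpha> (\<beta> + 2 * q) \<gamma> \<delta>) (mon4 (\<alpha> + q) \<beta> (\<gamma> + q) \<delta>) \<in> J" for \<alpha> \<beta> \<gamma> \<delta> q
  proof (induction q arbitrary: \<alpha> \<gamma>)
    case (Suc q)
    have "bin (mon4 \<alpha> (\<beta> + 2 * Suc q) \<gamma> \<delta>) (mon4 (\<alpha> + 1) (\<beta> + 2 * q) (\<gamma> + 1) \<delta>) \<in> J"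
      using shift[OF gens(1), of \<alpha> "\<beta> + 2 * q" \<gamma> \<delta>] by (simp add: mon4_add)
    from trans[OF this Suc.IH[of "\<alpha> + 1" "\<gamma> + 1"]] show ?case by simp
  qed (use JD in \<open>simp add: bin_def\<close>)
  have red_g: "bin (mon4 (\<alpha> + (a + e) * q) \<beta> \<gamma> \<delta>) (mon4 \<alpha> \<beta> (\<gamma> + a * q) (\<delta> + e * q)) \<in> J" for \<alpha> \<beta> \<gamma> \<delta> q
  proof (induction q arbitrary: \<gamma> \<delta>)
    case (Suc q)
    have "bin (mon4 (\<alpha> + (a + e) * Suc q) \<beta> \<gamma> \<delta>) (mon4 (\<alpha> + (a + e) * q) \<beta> (\<gamma> + a) (\<delta> + e)) \<in> J"
      using shift[OF gens(2), of "\<alpha> + (a + e) * q" \<beta> \<gamma> \<delta>] by (simp add: mon4_add algebra_simps)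
    from trans[OF this Suc.IH[of "\<gamma> + a" "\<delta> + e"]] show ?case by (simp add: algebra_simps)
  qed (use JD in \<open>simp add: bin_def\<close>)
  have nf: "\<exists>x1 x2 x3 x4. x1 < a + e \<and> x2 < 2 \<and> bin m (mon4 x1 x2 x3 x4) \<in> J \<and> ?w m = ?w (mon4 x1 x2 x3 x4)"
    if "Poly_Mapping.keys m \<subseteq> {1..4}" for m
  proof -
    from mon4_cases[OF that] obtain \<alpha> \<beta> \<gamma> \<delta> where m: "m = mon4 \<alpha> \<beta> \<gamma> \<delta>"
      by blast
    \<comment> \<open>Squares of the second variable go first, since this raises the exponent of the
      first; the reduction modulo \<open>a + e\<close> then leaves the second variable
      untouched.\<close>
    define \<alpha>' q where q: "\<alpha>' = \<alpha> + \<beta> div 2" "q = \<alpha>' div (a + e)"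
    let ?n = "mon4 (\<alpha>' mod (a + e)) (\<beta> mod 2) (\<gamma> + \<beta> div 2 + a * q) (\<delta> + e * q)"
    have "bin m (mon4 \<alpha>' (\<beta> mod 2) (\<gamma> + \<beta> div 2) \<delta>) \<in> J"
      using red_f[of \<alpha> "\<beta> mod 2" "\<beta> div 2" \<gamma> \<delta>] by (simp add: m q(1))
    moreover have "bin (mon4 \<alpha>' (\<beta> mod 2) (\<gamma> + \<beta> div 2) \<delta>) ?n \<in> J"
      using red_g[of "\<alpha>' mod (a + e)" q "\<beta> mod 2" "\<gamma> + \<beta> div 2" \<delta>] by (simp add: q(2))
    ultimately have "bin m ?n \<in> J" by (rule trans)
    moreover have "\<alpha>' mod (a + e) < a + e" "\<beta> mod 2 < 2" using a(3) by auto
    \<comment> \<open>A binomial of \<open>J\<close> lies in the toric ideal, and its push-forward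
      vanishes only if both monomials have the same weight.\<close>
    moreover have "?w m = ?w ?n"
    proof -
      have "push ?w (bin m ?n) = 0" using \<open>bin m ?n \<in> J\<close> sub by (auto simp: toric_kernel_def)
      hence "Poly_Mapping.single (?w m) (1::'k) = Poly_Mapping.single (?w ?n) 1"
        by (simp add: bin_def push_diff)
      thus ?thesis by (metis lookup_single_eq lookup_single_not_eq zero_neq_one)
    qed
    ultimately show ?thesis by blast
  qed
  have "toric_kernel {1..4} ?w \<subseteq> J"
  proof (rule toric_kernel_subset_ideal[OF J])
    fix m m' :: "nat \<Rightarrow>\<^sub>0 nat"
    assume m: "Poly_Mapping.keys m \<subseteq> {1..4}" "Poly_Mapping.keys m' \<subseteq> {1..4}" "?w m = ?w m'"
    obtain x1 x2 x3 x4 where x: "x1 < a + e" "x2 < 2" "bin m (mon4 x1 x2 x3 x4) \<in> J" "?w m = ?w (mon4 x1 x2 x3 x4)"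
      using nf[OF m(1)] by blast
    obtain y1 y2 y3 y4 where y: "y1 < a + e" "y2 < 2" "bin m' (mon4 y1 y2 y3 y4) \<in> J" "?w m' = ?w (mon4 y1 y2 y3 y4)"
      using nf[OF m(2)] by blast
    have eq: "?w (mon4 x1 x2 x3 x4) = ?w (mon4 y1 y2 y3 y4)" using m(3) x(4) y(4) by simp
    hence "x1 = y1 \<and> x2 = y2 \<and> x3 = y3"
      unfolding w using x y a by (intro even_normal_form_unique) auto
    \<comment> \<open>The extra variable has weight 0, so its exponent is recovered from the
      degree.\<close>
    moreover from this have "x4 = y4" using eq unfolding w by simp
    ultimately have "bin m (mon4 y1 y2 y3 y4) \<in> J" using x(3) by simp
    from trans[OF this sym[OF y(3)]]
    show "Poly_Mapping.single m 1 - Poly_Mapping.single m' 1 \<in> J" by (simp add: bin_def)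
  qed
  with sub have "Idl\<^bsub>?R\<^esub> {?f, ?g} = toric_kernel {1..4} ?w" unfolding J_def by blast
  hence "min_num_generators ?R (toric_kernel {1..4} ?w) \<le> enat (card {?f, ?g})"
    unfolding min_num_generators_def using bin_carrier by (intro INF_lower) auto
  also have "\<dots> \<le> enat 2" by (simp add: card_insert_if)
  finally show ?thesis unfolding I by simp
qed

text \<open>The general lower bound with no extra monomial meets the two explicit
  generators.\<close>

lemma arithmetic_even_complete_intersection:
  assumes d: "d 1 = 2 * a" "d 2 = 2 * a + e" "d 3 = 2 * a + 2 * e"
    and a: "odd e" "coprime a e" "a > (0::nat)"
  shows "proj_toric_complete_intersection TYPE('k::field) 3 d"
proof -
  have mono: "strict_mono_on {1..3} d"
    using d a(1) by (intro strict_mono_on_3) (auto intro: Nat.gr0I)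
  have "enat (3 - 1 + card ({} :: (nat \<Rightarrow>\<^sub>0 nat) set)) \<le>
      min_num_generators (mpoly_ring {1..3 + 1}) (proj_toric_ideal 3 d :: 'k mpoly set)"
    by (rule min_num_generators_ge[OF mono]) (use d a in auto)
  with arithmetic_even_min_num_generators_le[OF assms, where 'k = 'k] show ?thesis
    unfolding proj_toric_complete_intersection_def by (simp add: order_antisym)
qed

theorem theorem6p1:
  fixes d :: "nat \<Rightarrow> nat" and n :: nat
  assumes "n \<ge> 3"
    and "\<forall>i\<in>{1..n}. d i > 0"
    and "generalized_arithmetic_sequence n d"
    and "Gcd (d ` {1..n}) = 1"
  shows "proj_toric_complete_intersection TYPE('k::field) n d \<longleftrightarrow>
    n = 3 \<and> increasing_arithmetic_sequence n d \<and> even (d 1)"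
proof -
  obtain h e where h: "h > 0" and e: "e > 0"
    and step: "\<And>i. i \<in> {1..<n} \<Longrightarrow> (d(1 := h * d 1)) (i + 1) = (d(1 := h * d 1)) i + e"
    using assms(3) by (auto simp: generalized_arithmetic_sequence_def increasing_arithmetic_sequence_def)
  \<comment> \<open>The formula starts at the second term; the first would satisfy it only for
    \<open>h = 1\<close>.\<close>
  have dSuc: "d (Suc i) = h * d 1 + i * e" if "1 \<le> i" "Suc i \<le> n" for i
    using that
  proof (induction i rule: nat_induct_at_least)
    case base
    thus ?case using step[of 1] by simp
  next
    case (Suc i)
    thus ?case using step[of "Suc i"] by simp
  qed
  have d1: "d 1 > 0" using assms(1,2) by simp
  have d23: "d 2 = h * d 1 + e" "d 3 = h * d 1 + 2 * e"
    using dSuc[of 1] dSuc[of 2] assms(1) by (simp_all add: numeral_eq_Suc)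
  have d4: "d 4 = h * d 1 + 3 * e" if "n \<ge> 4"
    using dSuc[of 3] that by (simp add: numeral_eq_Suc)
  have d5: "d 5 = h * d 1 + 4 * e" if "n \<ge> 5"
    using dSuc[of 4] that by (simp add: numeral_eq_Suc)
  have mono: "strict_mono_on {1..n} d"
  proof (rule strict_mono_onI)
    fix i j assume ij: "i \<in> {1..n}" "j \<in> {1..n}" "i < j"
    then obtain j' where j: "j = Suc j'" "1 \<le> j'" "Suc j' \<le> n" by (cases j) auto
    show "d i < d j"
    proof (cases "i = 1")
      case True
      have "1 * d 1 \<le> h * d 1" using h by (intro mult_le_mono1) simp
      moreover have "0 < j' * e" using j e by simp
      ultimately show ?thesis unfolding True j(1) dSuc[OF j(2,3)] by linarith
    next
      case False
      then obtain i' where i: "i = Suc i'" "1 \<le> i'" "Suc i' \<le> n" using ij by (cases i) auto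
      have "i' * e < j' * e" using i j ij e by simp
      thus ?thesis using dSuc[OF i(2,3)] dSuc[OF j(2,3)] i(1) j(1) by simp
    qed
  qed
  \<comment> \<open>A common divisor of \<open>d 1\<close> and \<open>e\<close> divides every term
    of the sequence.\<close>
  have cop: "coprime (d 1) e"
  proof (rule coprimeI)
    fix c assume c: "c dvd d 1" "c dvd e"
    have "c dvd d i" if "i \<in> {1..n}" for i
    proof (cases "i = 1")
      case False
      then obtain i' where "i = Suc i'" "1 \<le> i'" "Suc i' \<le> n" using \<open>i \<in> {1..n}\<close> by (cases i) auto
      thus ?thesis using dSuc[of i'] c by simp
    qed (use c in simp)
    hence "c dvd Gcd (d ` {1..n})" by (auto intro: Gcd_greatest)
    thus "is_unit c" using assms(4) by simp
  qed
  have arith: "increasing_arithmetic_sequence 3 d \<longleftrightarrow> h = 1"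
  proof
    assume "increasing_arithmetic_sequence 3 d"
    then obtain e' where "d (1 + 1) = d 1 + e'" "d (2 + 1) = d 2 + e'"
      unfolding increasing_arithmetic_sequence_def by fastforce
    hence "h * d 1 = d 1" using d23 by (auto simp: numeral_eq_Suc)
    thus "h = 1" using d1 by simp
  next
    assume "h = 1"
    hence "d (i + 1) = d i + e" if "i \<in> {1..<3}" for i
      using step[of i] that assms(1) by (auto split: if_splits)
    thus "increasing_arithmetic_sequence 3 d"
      using e by (auto simp: increasing_arithmetic_sequence_def)
  qed
  note not_ci = quadric_not_complete_intersection[OF mono _ d1, where 'k = 'k]
  consider "n \<ge> 5" | "n = 4" "h = 1" | "n = 3 \<or> n = 4" "h \<ge> 2" | "n = 3" "h = 1"
    using assms(1) h by linarith
  thus ?thesis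
  proof cases
    case 1
    \<comment> \<open>The indices start at 2 because from there on the sequence is arithmetic for
      every \<open>h\<close>.\<close>
    thus ?thesis using not_ci[of 2 3 4 5] d23 d4 d5 by simp
  next
    case 2
    thus ?thesis using not_ci[of 1 2 3 4] d23 d4 by simp
  next
    case 3
    hence "\<not> proj_toric_complete_intersection TYPE('k) n d"
      using mono d23 d4 d1 e cop
      by (intro generalized_not_complete_intersection[of n d "d 1" h e]) auto
    thus ?thesis using 3 arith by auto
  next
    case 4
    show ?thesis
    proof (cases "even (d 1)")
      case True
      then obtain a where a: "d 1 = 2 * a" by auto
      \<comment> \<open>Being prime to \<open>2 * a\<close> splits into oddness of \<open>e\<close>
        and coprimality with \<open>a\<close>.\<close>
      have "coprime a e" "odd e" using cop unfolding a by simp_all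
      hence "proj_toric_complete_intersection TYPE('k) 3 d"
        using 4 a d23 d1 by (intro arithmetic_even_complete_intersection[of d a e]) auto
      thus ?thesis using 4 arith True by simp
    next
      case False
      hence "\<not> proj_toric_complete_intersection TYPE('k) 3 d"
        using 4 d23 cop e by (intro arithmetic_odd_not_complete_intersection[of d "d 1" e]) auto
      thus ?thesis using 4 False by simp
    qed
  qed
qed

end
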